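(* Let $f(z)=P(z)/q(z)$ be a rational multiaffine real $m\times m$ matrix-valued function of $z=(z_1,\dots,z_d)$, where $P$ is a real $m\times m$ matrix-valued form and $q\not\equiv 0$ is a real scalar form, and suppose $f$ is homogeneous of degree one: $f(\lambda z)=\lambda f(z)$ for $\lambda\in\mathbb{C}\setminus\{0\}$. Then $f$ belongs to the class $\mathbb{R}\mathcal{P}_d^{m\times m}$ if and only if all the Wronskians $$W_{z_k}[q,P]=q(z)\frac{\partial P(z)}{\partial z_k}-P(z)\frac{\partial q(z)}{\partial z_k},\qquad k=1,\dots,d,$$ are PSD forms.
   Context: A form is a homogeneous polynomial with real coefficients; a matrix-valued form is a matrix polynomial all of whose entries are homogeneous of one common degree. The function $P/q$ is multiaffine if $P$ and $q$ have degree at most one in each variable $z_k$ separately. A matrix-valued form $F(z)$ is a PSD form if for every $x\in\mathbb{R}^d$ the real matrix $F(x)$ is symmetric and positive semidefinite. $M^*=\overline M^T$; $\ge0$ for Hermitian matrices means positive semidefinite. $\Pi^d=\{z\in\mathbb{C}^d:\operatorname{Re}z_1>0,\dots,\operatorname{Re}z_d>0\}$. $\mathbb{R}\mathcal{P}_d^{m\times m}$ is the class of rational $m\times m$ matrix-valued functions $f(z)=f(z_1,\dots,z_d)$ satisfying: (i) $\overline{f(\overline z_1,\dots,\overline z_d)}=f(z_1,\dots,z_d)$; (ii) $f(z)^T=f(z)$; (iii) $f(\lambda z)=\lambda f(z)$ for $\lambda\in\mathbb{C}\setminus\{0\}$; (iv) $f(z)+f(z)^*\ge0$ for $z\in\Pi^d$;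 (v) $f$ is holomorphic on $\Pi^d$. *)

theory Defs
  imports
    "HOL-Analysis.Analysis"
    "HOL-Library.Poly_Mapping"
    "HOL-Computational_Algebra.Fraction_Field"
begin

text \<open>
  The variables \<open>z\<^sub>1, \<dots>, z\<^sub>d\<close> are indexed by a finite type \<open>'d\<close>, matrix rows and columns by a
  finite type \<open>'m\<close>. A polynomial is a finitely supported map from exponents to coefficients.
  The sort \<open>linorder\<close> on \<open>'d\<close> occurs only because the library proves that polynomials form an
  integral domain, which the type of fractions requires, under that sort; the choice of the
  order has no other effect.
\<close>

type_synonym ('a, 'd) mpoly = "('d \<Rightarrow>\<^sub>0 nat) \<Rightarrow>\<^sub>0 'a"

definition mpoly_eval :: "('a::comm_semiring_1, 'd::finite) mpoly \<Rightarrow> 'a ^ 'd \<Rightarrow> 'a" where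
  "mpoly_eval p z =
     (\<Sum>\<alpha>\<in>Poly_Mapping.keys p. Poly_Mapping.lookup p \<alpha> * (\<Prod>k\<in>UNIV. (z $ k) ^ Poly_Mapping.lookup \<alpha> k))"

text \<open>Exponents are subtracted with truncation, but where that matters the coefficient is zero.\<close>

definition mpoly_pderiv :: "'d \<Rightarrow> ('a::comm_semiring_1, 'd) mpoly \<Rightarrow> ('a, 'd) mpoly" where
  "mpoly_pderiv k p =
     (\<Sum>\<alpha>\<in>Poly_Mapping.keys p.
        Poly_Mapping.single (\<alpha> - Poly_Mapping.single k 1)
          (of_nat (Poly_Mapping.lookup \<alpha> k) * Poly_Mapping.lookup p \<alpha>))"

text \<open>The zero polynomial is homogeneous of every degree.\<close>

definition homogeneous :: "nat \<Rightarrow> ('a::zero, 'd::finite) mpoly \<Rightarrow> bool" where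
  "homogeneous n p \<longleftrightarrow>
     (\<forall>\<alpha>\<in>Poly_Mapping.keys p. (\<Sum>k\<in>UNIV. Poly_Mapping.lookup \<alpha> k) = n)"

definition multiaffine :: "('a::zero, 'd) mpoly \<Rightarrow> bool" where
  "multiaffine p \<longleftrightarrow> (\<forall>\<alpha>\<in>Poly_Mapping.keys p. \<forall>k. Poly_Mapping.lookup \<alpha> k \<le> 1)"

definition real_form :: "(real, 'd::finite) mpoly \<Rightarrow> bool" where
  "real_form p \<longleftrightarrow> (\<exists>n. homogeneous n p)"

definition real_matrix_form :: "(real, 'd::finite) mpoly ^ 'm ^ 'm \<Rightarrow> bool" where
  "real_matrix_form P \<longleftrightarrow> (\<exists>n. \<forall>i j. homogeneous n (P $ i $ j))"

definition psd_form :: "(real, 'd::finite) mpoly ^ 'm ^ 'm \<Rightarrow> bool" where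
  "psd_form F \<longleftrightarrow>
     real_matrix_form F \<and>
     (\<forall>x :: real ^ 'd. let A = (\<chi> i j. mpoly_eval (F $ i $ j) x) :: real ^ 'm ^ 'm in
        transpose A = A \<and> (\<forall>v. 0 \<le> v \<bullet> (A *v v)))"

definition wronskian ::
  "'d \<Rightarrow> (real, 'd) mpoly \<Rightarrow> (real, 'd) mpoly ^ 'm ^ 'm \<Rightarrow> (real, 'd) mpoly ^ 'm ^ 'm" where
  "wronskian k q P = (\<chi> i j. q * mpoly_pderiv k (P $ i $ j) - P $ i $ j * mpoly_pderiv k q)"

text \<open>Rational functions with complex coefficients; \<open>P/q\<close> need not be in lowest terms.\<close>

type_synonym 'd ratfun = "(complex, 'd) mpoly fract"

definition complex_mpoly :: "(real, 'd) mpoly \<Rightarrow> (complex, 'd) mpoly" where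
  "complex_mpoly p = Poly_Mapping.map complex_of_real p"

definition matrix_quotient ::
  "(real, 'd::{finite, linorder}) mpoly ^ 'm ^ 'm \<Rightarrow> (real, 'd) mpoly \<Rightarrow> 'd ratfun ^ 'm ^ 'm" where
  "matrix_quotient P q = (\<chi> i j. Fract (complex_mpoly (P $ i $ j)) (complex_mpoly q))"

text \<open>
  A rational function is a partial function: it is defined at \<open>z\<close> if one of its
  representations as a fraction has a denominator that does not vanish at \<open>z\<close>, and its value
  there does not depend on the representation.
\<close>

definition ratfun_value ::
  "'d::{finite, linorder} ratfun \<Rightarrow> complex ^ ('d::{finite, linorder}) \<Rightarrow> complex \<Rightarrow> bool" where
  "ratfun_value r z w \<longleftrightarrow>
     (\<exists>a b. r = Fract a b \<and> mpoly_eval b z \<noteq> 0 \<and> w = mpoly_eval a z / mpoly_eval b z)"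

definition matfun_value ::
  "'d::{finite, linorder} ratfun ^ 'm ^ 'm \<Rightarrow> complex ^ ('d::{finite, linorder}) \<Rightarrow> complex ^ 'm ^ 'm \<Rightarrow> bool" where
  "matfun_value f z W \<longleftrightarrow> (\<forall>i j. ratfun_value (f $ i $ j) z (W $ i $ j))"

text \<open>
  \<open>f(\<lambda>z) = \<lambda>f(z)\<close> as an equality of partial functions, i.e. one side is defined iff the other is.
\<close>

definition homogeneous_deg_one :: "'d::{finite, linorder} ratfun ^ 'm ^ 'm \<Rightarrow> bool" where
  "homogeneous_deg_one f \<longleftrightarrow>
     (\<forall>c z W. c \<noteq> 0 \<longrightarrow>
        (matfun_value f (c *s z) (\<chi> i j. c * W $ i $ j) \<longleftrightarrow> matfun_value f z W))"

definition right_polyhalfplane :: "(complex ^ 'd) set" where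
  "right_polyhalfplane = {z. \<forall>k. 0 < Re (z $ k)}"

definition conj_transpose :: "complex ^ 'm ^ 'm \<Rightarrow> complex ^ 'm ^ 'm" where
  "conj_transpose A = (\<chi> i j. cnj (A $ j $ i))"

definition hermitian_psd :: "complex ^ 'm ^ 'm \<Rightarrow> bool" where
  "hermitian_psd H \<longleftrightarrow>
     conj_transpose H = H \<and>
     (\<forall>v :: complex ^ 'm. 0 \<le> Re (\<Sum>i\<in>UNIV. cnj (v $ i) * (H *v v) $ i))"

text \<open>
  Holomorphy in several variables on an open set: every entry has a complex-linear Frechet
  derivative at every point.
\<close>

definition matrix_holomorphic_on ::
  "(complex ^ 'd::finite \<Rightarrow> complex ^ 'm ^ 'm) \<Rightarrow> (complex ^ 'd) set \<Rightarrow> bool" where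
  "matrix_holomorphic_on g S \<longleftrightarrow>
     (\<forall>z\<in>S. \<forall>i j. \<exists>c :: complex ^ 'd.
        ((\<lambda>y. g y $ i $ j) has_derivative (\<lambda>h. \<Sum>k\<in>UNIV. c $ k * h $ k)) (at z))"

text \<open>
  The class of rational matrix functions \<open>f\<close> that are real, symmetric, homogeneous of degree
  one, and holomorphic with positive semidefinite \<open>f + f\<^sup>*\<close> on the right poly-half-plane. As for
  any rational function, holomorphy there allows removable singularities: \<open>g\<close> is the
  holomorphic function given by \<open>f\<close>.
\<close>

definition RP_class :: "('d::{finite, linorder} ratfun ^ 'm ^ 'm) set" where
  "RP_class = {f.
     (\<forall>z W. matfun_value f (\<chi> k. cnj (z $ k)) (\<chi> i j. cnj (W $ i $ j)) \<longleftrightarrow> matfun_value f z W) \<and>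
     transpose f = f \<and>
     homogeneous_deg_one f \<and>
     (\<exists>g. matrix_holomorphic_on g right_polyhalfplane \<and>
          (\<forall>z\<in>right_polyhalfplane. \<forall>W. matfun_value f z W \<longrightarrow> g z = W) \<and>
          (\<forall>z\<in>right_polyhalfplane. hermitian_psd (g z + conj_transpose (g z))))}"

end

theory Submission
  imports Defs
begin

text \<open>
  By homogeneity \<open>f(\<i> z) = \<i> f(z)\<close>, so a nonnegative real part of \<open>f\<close> on the right
  poly-half-plane is the same as a nonnegative imaginary part on the upper one. For a real vector
  \<open>v\<close> put \<open>p = v\<^sup>T P v\<close>; this is again a real multiaffine polynomial, its Wronskian with \<open>q\<close> is the
  quadratic form of the matrix Wronskian, and the condition reads \<open>Im (p(z) cnj (q(z))) \<ge> 0\<close>.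
  This form of the condition also makes sense at the zeros of \<open>q\<close>.

  Positivity gives the Wronskian inequalities (\<open>upper_imp_wronskian_nonneg\<close>): if \<open>x\<close> is real, then
  \<open>Im (p cnj q)\<close> at \<open>x + \<i> e\<^sub>k\<close> is exactly the Wronskian in \<open>z\<^sub>k\<close> at \<open>x\<close>, because both functions
  are affine in \<open>z\<^sub>k\<close>; and this point is a limit of points of the upper poly-half-plane.

  The converse (\<open>wronskian_nonneg_imp_upper\<close>) moves the coordinates from the real line into the
  upper half-plane one at a time. As a function of the coordinate that is moved, \<open>p/q\<close> is a Moebius
  transformation which maps the real line into the closed upper half-plane, that is, to a circle
  there; the only question is whether it maps the upper half-plane to the inside of this circle or
  to the outside. A real number \<open>R\<close> records the orientation. It cannot vanish unless the determinant
  of the transformation, which is the Wronskian, does; and at real points it equals the Wronskian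
  and is therefore nonnegative. Along a complex line through the given point the Wronskian is
  identically zero, in which case the transformation is degenerate and harmless, or it has finitely
  many zeros. The upper half-plane without them is connected, so \<open>R\<close> keeps its sign there.

  For membership in the class, \<open>f\<close> must also extend holomorphically over the zeros of \<open>q\<close>. If \<open>q\<close>
  has a zero in the upper poly-half-plane that disappears when \<open>z\<^sub>k\<close> is changed, then positivity
  forces \<open>p\<close> to vanish at this zero and at all nearby ones, and so the Wronskian in \<open>z\<^sub>k\<close> vanishes
  identically (\<open>wronski_vanishes\<close>): \<open>f\<close> does not depend on \<open>z\<^sub>k\<close>, and a real number can be
  substituted for \<open>z\<^sub>k\<close>. After finitely many substitutions the denominator has no zeros left
  (\<open>denominator_free_of_zeros\<close>), and the new fraction is the extension.

  The symmetry of \<open>f\<close> follows from that of the Wronskians by Euler's identity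
  (\<open>symmetric_of_wronskian\<close>).
\<close>

section \<open>Evaluation of polynomials\<close>

lemma poly_mapping_sum_single:
  fixes p :: "'b \<Rightarrow>\<^sub>0 'a::comm_monoid_add"
  shows "(\<Sum>\<alpha>\<in>Poly_Mapping.keys p. Poly_Mapping.single \<alpha> (Poly_Mapping.lookup p \<alpha>)) = p"
  by (rule poly_mapping_eqI)
    (simp add: lookup_sum lookup_single when_def in_keys_iff)

lemma mpoly_monomial_induct [case_names zero single add]:
  fixes p :: "'b \<Rightarrow>\<^sub>0 'a::comm_monoid_add"
  assumes "Q 0" "\<And>\<alpha> c. Q (Poly_Mapping.single \<alpha> c)" "\<And>p q. Q p \<Longrightarrow> Q q \<Longrightarrow> Q (p + q)"
  shows "Q p"
proof -
  have "Q (\<Sum>\<alpha>\<in>A. Poly_Mapping.single \<alpha> (Poly_Mapping.lookup p \<alpha>))" if "finite A" for A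
    using that by induction (auto intro: assms)
  from this[of "Poly_Mapping.keys p"] show ?thesis
    by (simp add: poly_mapping_sum_single)
qed

definition monomial_eval :: "('d::finite \<Rightarrow>\<^sub>0 nat) \<Rightarrow> 'a::comm_semiring_1 ^ 'd \<Rightarrow> 'a" where
  "monomial_eval \<alpha> z = (\<Prod>k\<in>UNIV. (z $ k) ^ Poly_Mapping.lookup \<alpha> k)"

lemma mpoly_eval_superset:
  assumes "finite A" "Poly_Mapping.keys p \<subseteq> A"
  shows "mpoly_eval p z = (\<Sum>\<alpha>\<in>A. Poly_Mapping.lookup p \<alpha> * monomial_eval \<alpha> z)"
  unfolding mpoly_eval_def monomial_eval_def
  using assms by (intro sum.mono_neutral_left) (auto simp: in_keys_iff)

lemma mpoly_eval_zero [simp]: "mpoly_eval 0 z = 0"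
  by (simp add: mpoly_eval_def)

lemma mpoly_eval_single [simp]: "mpoly_eval (Poly_Mapping.single \<alpha> c) z = c * monomial_eval \<alpha> z"
  by (subst mpoly_eval_superset[of "{\<alpha>}"]) auto

lemma mpoly_eval_add [simp]: "mpoly_eval (p + q) z = mpoly_eval p z + mpoly_eval q z"
proof -
  let ?A = "Poly_Mapping.keys p \<union> Poly_Mapping.keys q"
  have "Poly_Mapping.keys (p + q) \<subseteq> ?A" by (rule keys_add)
  then show ?thesis
    by (simp add: mpoly_eval_superset[of ?A] lookup_add distrib_right sum.distrib)
qed

lemma mpoly_eval_diff [simp]:
  fixes p q :: "('a::comm_ring_1, 'd::finite) mpoly"
  shows "mpoly_eval (p - q) z = mpoly_eval p z - mpoly_eval q z"
  using mpoly_eval_add[of "p - q" q z] by simp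

lemma mpoly_eval_sum: "mpoly_eval (\<Sum>i\<in>I. p i) z = (\<Sum>i\<in>I. mpoly_eval (p i) z)"
  by (induction I rule: infinite_finite_induct) auto

lemma monomial_eval_add: "monomial_eval (\<alpha> + \<beta>) z = monomial_eval \<alpha> z * monomial_eval \<beta> z"
  by (simp add: monomial_eval_def lookup_add power_add prod.distrib)

lemma mpoly_eval_mult [simp]:
  fixes p q :: "('a::comm_semiring_1, 'd::finite) mpoly"
  shows "mpoly_eval (p * q) z = mpoly_eval p z * mpoly_eval q z"
proof (induction p rule: mpoly_monomial_induct)
  case (single \<alpha> c)
  show ?case
    by (induction q rule: mpoly_monomial_induct)
      (auto simp: mult_single monomial_eval_add algebra_simps)
qed (auto simp: algebra_simps)

text \<open>
  The two changes of coefficients that occur are the inclusion of the reals into the complex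
  numbers and complex conjugation.
\<close>

locale coefficient_hom =
  fixes h :: "'a::comm_ring_1 \<Rightarrow> 'b::comm_ring_1"
  assumes hom_add: "h (a + b) = h a + h b"
    and hom_mult: "h (a * b) = h a * h b"
    and hom_one: "h 1 = 1"
begin

lemma hom_zero [simp]: "h 0 = 0"
  using hom_add[of 0 0] by simp

lemma lookup_map_hom [simp]: "Poly_Mapping.lookup (Poly_Mapping.map h p) \<alpha> = h (Poly_Mapping.lookup p \<alpha>)"
  by (simp add: Poly_Mapping.map.rep_eq when_def)

lemma map_hom_add: "Poly_Mapping.map h (p + q) = Poly_Mapping.map h p + Poly_Mapping.map h q"
  by (rule poly_mapping_eqI) (simp add: lookup_add hom_add)

lemma map_hom_single:
  "Poly_Mapping.map h (Poly_Mapping.single \<alpha> c) = Poly_Mapping.single \<alpha> (h c)"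
  by (rule poly_mapping_eqI) (simp add: lookup_single when_def)

lemma map_hom_zero: "Poly_Mapping.map h 0 = 0"
  by (rule poly_mapping_eqI) simp

lemma map_hom_mult:
  fixes p q :: "('a, 'd::finite) mpoly"
  shows "Poly_Mapping.map h (p * q) = Poly_Mapping.map h p * Poly_Mapping.map h q"
proof (induction p rule: mpoly_monomial_induct)
  case (single \<alpha> c)
  show ?case
    by (induction q rule: mpoly_monomial_induct)
      (auto simp: mult_single map_hom_add map_hom_single map_hom_zero hom_mult distrib_left)
qed (auto simp: map_hom_add map_hom_zero distrib_right)

lemma hom_power: "h (a ^ n) = h a ^ n"
  by (induction n) (auto simp: hom_one hom_mult)

lemma hom_prod: "h (\<Prod>i\<in>I. g i) = (\<Prod>i\<in>I. h (g i))"
  by (induction I rule: infinite_finite_induct) (auto simp: hom_one hom_mult)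

lemma mpoly_eval_map_hom:
  "mpoly_eval (Poly_Mapping.map h p) (\<chi> k. h (z $ k)) = h (mpoly_eval p z)"
  by (induction p rule: mpoly_monomial_induct)
    (auto simp: map_hom_add map_hom_single map_hom_zero hom_add hom_mult monomial_eval_def
        hom_prod hom_power)

end

interpretation of_real_hom: coefficient_hom complex_of_real
  by unfold_locales auto

interpretation cnj_hom: coefficient_hom cnj
  by unfold_locales auto

lemma lookup_complex_mpoly [simp]:
  "Poly_Mapping.lookup (complex_mpoly p) \<alpha> = complex_of_real (Poly_Mapping.lookup p \<alpha>)"
  by (simp add: complex_mpoly_def)

lemma keys_complex_mpoly [simp]: "Poly_Mapping.keys (complex_mpoly p) = Poly_Mapping.keys p"
  by (auto simp: in_keys_iff)

lemma complex_mpoly_inject [simp]: "complex_mpoly p = complex_mpoly q \<longleftrightarrow> p = q"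
  by (auto simp: poly_mapping_eq_iff fun_eq_iff)

lemma complex_mpoly_eq_0_iff [simp]: "complex_mpoly p = 0 \<longleftrightarrow> p = 0"
  by (auto simp: poly_mapping_eq_iff fun_eq_iff)

lemma map_cnj_complex_mpoly [simp]: "Poly_Mapping.map cnj (complex_mpoly p) = complex_mpoly p"
  by (rule poly_mapping_eqI) simp

definition complexify :: "real ^ 'd \<Rightarrow> complex ^ 'd" where
  "complexify x = (\<chi> k. complex_of_real (x $ k))"

lemma complexify_nth [simp]: "complexify x $ k = complex_of_real (x $ k)"
  by (simp add: complexify_def)

lemma mpoly_eval_complexify:
  "mpoly_eval (complex_mpoly p) (complexify x) = complex_of_real (mpoly_eval p x)"
  unfolding complex_mpoly_def complexify_def by (rule of_real_hom.mpoly_eval_map_hom)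

lemma mpoly_eval_cnj:
  "mpoly_eval (complex_mpoly p) (\<chi> k. cnj (z $ k)) = cnj (mpoly_eval (complex_mpoly p) z)"
  using cnj_hom.mpoly_eval_map_hom[of "complex_mpoly p" z] by simp

section \<open>Multiaffine and homogeneous polynomials\<close>

text \<open>
  Replacing a coordinate by 0 and by 1 determines an affine function of this coordinate, so the
  substitution can stand in for the partial derivative.
\<close>

definition upd :: "'a ^ 'd \<Rightarrow> 'd \<Rightarrow> 'a \<Rightarrow> 'a ^ 'd" where
  "upd z k w = (\<chi> j. if j = k then w else z $ j)"

lemma upd_nth: "upd z k w $ j = (if j = k then w else z $ j)"
  by (simp add: upd_def)

lemma upd_upd [simp]: "upd (upd z k w) k w' = upd z k w'"
  by (simp add: upd_def vec_eq_iff)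

lemma upd_same [simp]: "upd z k (z $ k) = z"
  by (simp add: upd_def vec_eq_iff)

lemma multiaffine_complex_mpoly [simp]: "multiaffine (complex_mpoly p) \<longleftrightarrow> multiaffine p"
  by (simp add: multiaffine_def)

lemma homogeneous_complex_mpoly [simp]: "homogeneous n (complex_mpoly p) \<longleftrightarrow> homogeneous n p"
  by (simp add: homogeneous_def)

lemma mpoly_eval_pderiv:
  "mpoly_eval (mpoly_pderiv k p) z =
     (\<Sum>\<alpha>\<in>Poly_Mapping.keys p. of_nat (Poly_Mapping.lookup \<alpha> k) * Poly_Mapping.lookup p \<alpha> *
        monomial_eval (\<alpha> - Poly_Mapping.single k 1) z)"
  by (simp add: mpoly_pderiv_def mpoly_eval_sum)

lemma monomial_eval_upd:
  "monomial_eval \<alpha> (upd z k w) =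
     w ^ Poly_Mapping.lookup \<alpha> k * (\<Prod>j\<in>UNIV - {k}. (z $ j) ^ Poly_Mapping.lookup \<alpha> j)"
  unfolding monomial_eval_def by (subst prod.remove[of _ k]) (auto simp: upd_nth)

lemma monomial_eval_diff_single:
  "monomial_eval (\<alpha> - Poly_Mapping.single k 1) z =
     (z $ k) ^ (Poly_Mapping.lookup \<alpha> k - 1) *
       (\<Prod>j\<in>UNIV - {k}. (z $ j) ^ Poly_Mapping.lookup \<alpha> j)"
proof -
  have "(\<Prod>j\<in>UNIV - {k}. (z $ j) ^ Poly_Mapping.lookup (\<alpha> - Poly_Mapping.single k 1) j) =
        (\<Prod>j\<in>UNIV - {k}. (z $ j) ^ Poly_Mapping.lookup \<alpha> j)"
    by (rule prod.cong) (auto simp: lookup_minus lookup_single when_def)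
  then show ?thesis
    unfolding monomial_eval_def
    by (subst prod.remove[of _ k]) (auto simp: lookup_minus)
qed

lemma multiaffine_eval_upd:
  fixes p :: "('a::comm_ring_1, 'd::finite) mpoly"
  assumes "multiaffine p"
  shows "mpoly_eval p (upd z k w) = mpoly_eval p (upd z k 0) + w * mpoly_eval (mpoly_pderiv k p) z"
proof -
  have "Poly_Mapping.lookup p \<alpha> * monomial_eval \<alpha> (upd z k w) =
      Poly_Mapping.lookup p \<alpha> * monomial_eval \<alpha> (upd z k 0) +
      w * (of_nat (Poly_Mapping.lookup \<alpha> k) * Poly_Mapping.lookup p \<alpha> *
        monomial_eval (\<alpha> - Poly_Mapping.single k 1) z)"
    if "\<alpha> \<in> Poly_Mapping.keys p" for \<alpha>
  proof -
    have "Poly_Mapping.lookup \<alpha> k = 0 \<or> Poly_Mapping.lookup \<alpha> k = 1"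
      using assms that by (auto simp: multiaffine_def le_Suc_eq)
    then show ?thesis
      unfolding monomial_eval_upd monomial_eval_diff_single
      by (elim disjE) (simp_all add: algebra_simps)
  qed
  then show ?thesis
    unfolding mpoly_eval_pderiv unfolding mpoly_eval_superset[OF finite_keys subset_refl]
      sum_distrib_left sum.distrib[symmetric]
    by (intro sum.cong) auto
qed

lemma homogeneous_eval_scale:
  assumes "homogeneous n p"
  shows "mpoly_eval p (c *s z) = c ^ n * mpoly_eval p z"
proof -
  have "monomial_eval \<alpha> (c *s z) = c ^ n * monomial_eval \<alpha> z"
    if "\<alpha> \<in> Poly_Mapping.keys p" for \<alpha>
    using assms that
    by (auto simp: homogeneous_def monomial_eval_def power_mult_distrib prod.distrib
        power_sum[symmetric])
  then show ?thesis
    unfolding mpoly_eval_superset[OF finite_keys subset_refl] sum_distrib_left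
    by (intro sum.cong) (auto simp: algebra_simps)
qed

lemma euler_identity:
  assumes "homogeneous n p"
  shows "(\<Sum>k\<in>UNIV. z $ k * mpoly_eval (mpoly_pderiv k p) z) = of_nat n * mpoly_eval p z"
proof -
  have mon: "z $ k * (of_nat (Poly_Mapping.lookup \<alpha> k) *
      monomial_eval (\<alpha> - Poly_Mapping.single k 1) z) =
      of_nat (Poly_Mapping.lookup \<alpha> k) * monomial_eval \<alpha> z" for k \<alpha>
  proof (cases "Poly_Mapping.lookup \<alpha> k")
    case (Suc l)
    then show ?thesis
      using monomial_eval_upd[of \<alpha> z k "z $ k"]
      by (simp only: monomial_eval_diff_single upd_same) (simp add: algebra_simps)
  qed simp
  have "(\<Sum>k\<in>UNIV. z $ k * mpoly_eval (mpoly_pderiv k p) z) =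
      (\<Sum>k\<in>UNIV. \<Sum>\<alpha>\<in>Poly_Mapping.keys p. Poly_Mapping.lookup p \<alpha> *
        (of_nat (Poly_Mapping.lookup \<alpha> k) * monomial_eval \<alpha> z))"
    unfolding mpoly_eval_pderiv sum_distrib_left mon[symmetric]
    by (intro sum.cong refl) (simp add: algebra_simps)
  also have "\<dots> = (\<Sum>\<alpha>\<in>Poly_Mapping.keys p. \<Sum>k\<in>UNIV. Poly_Mapping.lookup p \<alpha> *
        (of_nat (Poly_Mapping.lookup \<alpha> k) * monomial_eval \<alpha> z))"
    by (rule sum.swap)
  also have "\<dots> = (\<Sum>\<alpha>\<in>Poly_Mapping.keys p. of_nat n *
      (Poly_Mapping.lookup p \<alpha> * monomial_eval \<alpha> z))"
  proof (rule sum.cong)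
    fix \<alpha> assume "\<alpha> \<in> Poly_Mapping.keys p"
    then have n: "n = (\<Sum>k\<in>UNIV. Poly_Mapping.lookup \<alpha> k)"
      using assms by (auto simp: homogeneous_def)
    show "(\<Sum>k\<in>UNIV. Poly_Mapping.lookup p \<alpha> *
        (of_nat (Poly_Mapping.lookup \<alpha> k) * monomial_eval \<alpha> z)) =
      of_nat n * (Poly_Mapping.lookup p \<alpha> * monomial_eval \<alpha> z)"
      unfolding n by (simp add: sum_distrib_left sum_distrib_right algebra_simps)
  qed simp
  also have "\<dots> = of_nat n * mpoly_eval p z"
    unfolding mpoly_eval_superset[OF finite_keys subset_refl] sum_distrib_left ..
  finally show ?thesis .
qed

text \<open>
  At the indicator vector of the support of one exponent every other monomial of the same degree
  vanishes, so a coefficient can be read off.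
\<close>

lemma multiaffine_homogeneous_eval_nonzero:
  fixes p :: "('a::comm_semiring_1, 'd::finite) mpoly"
  assumes "multiaffine p" "homogeneous n p" "p \<noteq> 0"
  obtains x where "mpoly_eval p x \<noteq> 0"
proof -
  obtain \<alpha> where \<alpha>: "\<alpha> \<in> Poly_Mapping.keys p"
    using assms(3) by (metis equals0I keys_eq_empty)
  define x :: "'a ^ 'd" where "x = (\<chi> k. if Poly_Mapping.lookup \<alpha> k = 0 then 0 else 1)"
  have zero: "monomial_eval \<beta> x = 0" if \<beta>: "\<beta> \<in> Poly_Mapping.keys p" "\<beta> \<noteq> \<alpha>" for \<beta>
  proof (rule ccontr)
    assume nz: "monomial_eval \<beta> x \<noteq> 0"
    have le: "Poly_Mapping.lookup \<beta> k \<le> Poly_Mapping.lookup \<alpha> k" for k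
    proof -
      have "(x $ k) ^ Poly_Mapping.lookup \<beta> k \<noteq> 0"
        using nz unfolding monomial_eval_def by (metis finite iso_tuple_UNIV_I prod_zero)
      moreover have "Poly_Mapping.lookup \<beta> k \<le> 1"
        using assms(1) \<beta> by (auto simp: multiaffine_def)
      ultimately show ?thesis
        by (cases "Poly_Mapping.lookup \<beta> k") (auto simp: x_def split: if_splits)
    qed
    have "(\<Sum>k\<in>UNIV. Poly_Mapping.lookup \<beta> k) = (\<Sum>k\<in>UNIV. Poly_Mapping.lookup \<alpha> k)"
      using assms(2) \<alpha> \<beta> by (auto simp: homogeneous_def)
    then have "Poly_Mapping.lookup \<beta> k = Poly_Mapping.lookup \<alpha> k" for k
      using sum_mono_inv[of "Poly_Mapping.lookup \<beta>" UNIV "Poly_Mapping.lookup \<alpha>"] le by auto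
    then show False using \<beta>(2) by (auto intro: poly_mapping_eqI)
  qed
  have "mpoly_eval p x = (\<Sum>\<beta>\<in>{\<alpha>}. Poly_Mapping.lookup p \<beta> * monomial_eval \<beta> x)"
    unfolding mpoly_eval_superset[OF finite_keys subset_refl]
    using \<alpha> zero by (intro sum.mono_neutral_right) auto
  also have "monomial_eval \<alpha> x = 1"
    unfolding monomial_eval_def by (rule prod.neutral) (auto simp: x_def)
  then have "(\<Sum>\<beta>\<in>{\<alpha>}. Poly_Mapping.lookup p \<beta> * monomial_eval \<beta> x) = Poly_Mapping.lookup p \<alpha>"
    by simp
  finally have "mpoly_eval p x \<noteq> 0" using \<alpha> by (simp add: in_keys_iff)
  then show thesis by (rule that)
qed

lemma homogeneous_diff:
  fixes p q :: "('a::ab_group_add, 'd::finite) mpoly"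
  assumes "homogeneous n p" "homogeneous n q"
  shows "homogeneous n (p - q)"
  using assms unfolding homogeneous_def
  by (metis (no_types, lifting) diff_zero in_keys_iff lookup_minus)

lemma multiaffine_diff:
  fixes p q :: "('a::ab_group_add, 'd::finite) mpoly"
  assumes "multiaffine p" "multiaffine q"
  shows "multiaffine (p - q)"
  using assms unfolding multiaffine_def
  by (metis (no_types, lifting) diff_zero in_keys_iff lookup_minus)

lemma homogeneous_mult:
  fixes p q :: "('a::comm_semiring_1, 'd::finite) mpoly"
  assumes "homogeneous m p" "homogeneous n q"
  shows "homogeneous (m + n) (p * q)"
  unfolding homogeneous_def
proof
  fix \<gamma> assume "\<gamma> \<in> Poly_Mapping.keys (p * q)"
  then obtain \<alpha> \<beta> where "\<gamma> = \<alpha> + \<beta>" "\<alpha> \<in> Poly_Mapping.keys p" "\<beta> \<in> Poly_Mapping.keys q"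
    using keys_mult[of p q] by blast
  then show "(\<Sum>k\<in>UNIV. Poly_Mapping.lookup \<gamma> k) = m + n"
    using assms by (simp add: homogeneous_def lookup_add sum.distrib)
qed

lemma homogeneous_pderiv:
  assumes "homogeneous n p"
  shows "homogeneous (n - 1) (mpoly_pderiv k p)"
  unfolding homogeneous_def
proof
  fix \<gamma> assume "\<gamma> \<in> Poly_Mapping.keys (mpoly_pderiv k p)"
  then obtain \<alpha> where \<alpha>: "\<alpha> \<in> Poly_Mapping.keys p"
    and \<gamma>: "\<gamma> \<in> Poly_Mapping.keys (Poly_Mapping.single (\<alpha> - Poly_Mapping.single k 1)
      (of_nat (Poly_Mapping.lookup \<alpha> k) * Poly_Mapping.lookup p \<alpha>))"
    unfolding mpoly_pderiv_def using keys_sum by fast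
  have \<gamma>_eq: "\<gamma> = \<alpha> - Poly_Mapping.single k 1"
    using \<gamma> by (auto split: if_splits)
  have pos: "Poly_Mapping.lookup \<alpha> k \<noteq> 0"
    using \<gamma> by (intro notI) simp
  have "\<alpha> = \<gamma> + Poly_Mapping.single k 1"
    unfolding \<gamma>_eq using pos
    by (intro poly_mapping_eqI) (auto simp: lookup_add lookup_minus lookup_single when_def)
  moreover have "(\<Sum>j\<in>UNIV. Poly_Mapping.lookup \<alpha> j) = n"
    using assms \<alpha> by (auto simp: homogeneous_def)
  ultimately show "(\<Sum>j\<in>UNIV. Poly_Mapping.lookup \<gamma> j) = n - 1"
    by (auto simp: lookup_add sum.distrib lookup_single when_def)
qed

lemma pderiv_homogeneous_0:
  assumes "homogeneous 0 p"
  shows "mpoly_pderiv k p = 0"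
  using assms unfolding mpoly_pderiv_def homogeneous_def
  by (intro sum.neutral) auto

lemma homogeneous_zero [simp]: "homogeneous n 0"
  by (simp add: homogeneous_def)

lemma wronskian_homogeneous:
  fixes p q :: "(real, 'd::finite) mpoly"
  assumes p: "homogeneous n p" and q: "homogeneous m q"
  shows "homogeneous (n + m - 1) (q * mpoly_pderiv k p - p * mpoly_pderiv k q)"
proof (rule homogeneous_diff)
  show "homogeneous (n + m - 1) (q * mpoly_pderiv k p)"
  proof (cases n)
    case 0
    then show ?thesis using p by (simp add: pderiv_homogeneous_0)
  next
    case (Suc l)
    then show ?thesis
      using homogeneous_mult[OF q homogeneous_pderiv[OF p, of k]] by (simp add: add.commute)
  qed
  show "homogeneous (n + m - 1) (p * mpoly_pderiv k q)"
  proof (cases m)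
    case 0
    then show ?thesis using q by (simp add: pderiv_homogeneous_0)
  next
    case (Suc l)
    then show ?thesis
      using homogeneous_mult[OF p homogeneous_pderiv[OF q, of k]] by simp
  qed
qed

section \<open>Values of rational functions\<close>

text \<open>
  Where the given denominator does not vanish, every other representation of the fraction has the
  same value, because cross-multiplication is preserved by evaluation.
\<close>

lemma ratfun_value_Fract:
  assumes "mpoly_eval b z \<noteq> 0"
  shows "ratfun_value (Fract a b) z w \<longleftrightarrow> w = mpoly_eval a z / mpoly_eval b z"
proof
  assume "ratfun_value (Fract a b) z w"
  then obtain a' b' where *: "Fract a b = Fract a' b'" "mpoly_eval b' z \<noteq> 0"
    "w = mpoly_eval a' z / mpoly_eval b' z"
    by (auto simp: ratfun_value_def)
  have "b \<noteq> 0" "b' \<noteq> 0" using assms * by auto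
  then have "a * b' = a' * b" using * by (simp add: eq_fract)
  then have "mpoly_eval (a * b') z = mpoly_eval (a' * b) z" by simp
  then show "w = mpoly_eval a z / mpoly_eval b z"
    using assms * by (simp add: frac_eq_eq)
qed (use assms in \<open>auto simp: ratfun_value_def\<close>)

lemma ratfun_value_cross:
  assumes "ratfun_value (Fract a b) z w" "b \<noteq> 0"
  obtains a' b' where "a' * b = a * b'" "mpoly_eval b' z \<noteq> 0" "w = mpoly_eval a' z / mpoly_eval b' z"
proof -
  from assms obtain a' b' where *: "Fract a b = Fract a' b'" "mpoly_eval b' z \<noteq> 0"
    "w = mpoly_eval a' z / mpoly_eval b' z"
    by (auto simp: ratfun_value_def)
  then have "b' \<noteq> 0" by auto
  then have "a' * b = a * b'" using * assms(2) by (simp add: eq_fract)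
  then show thesis using * that by blast
qed

text \<open>
  Conjugating the coefficients of a representation of a fraction of real polynomials gives a
  representation of the same fraction.
\<close>

lemma ratfun_value_cnj:
  assumes b: "q \<noteq> 0"
    and val: "ratfun_value (Fract (complex_mpoly p) (complex_mpoly q)) z w"
  shows "ratfun_value (Fract (complex_mpoly p) (complex_mpoly q)) (\<chi> k. cnj (z $ k)) (cnj w)"
proof -
  obtain a b where ab: "a * complex_mpoly q = complex_mpoly p * b" "mpoly_eval b z \<noteq> 0"
    "w = mpoly_eval a z / mpoly_eval b z"
    using ratfun_value_cross[OF val] b by auto
  let ?a = "Poly_Mapping.map cnj a" and ?b = "Poly_Mapping.map cnj b"
  have ev: "mpoly_eval ?a (\<chi> k. cnj (z $ k)) = cnj (mpoly_eval a z)"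
    "mpoly_eval ?b (\<chi> k. cnj (z $ k)) = cnj (mpoly_eval b z)"
    by (rule cnj_hom.mpoly_eval_map_hom)+
  have "Poly_Mapping.map cnj (a * complex_mpoly q) = Poly_Mapping.map cnj (complex_mpoly p * b)"
    using ab(1) by simp
  then have "?a * complex_mpoly q = complex_mpoly p * ?b"
    by (simp add: cnj_hom.map_hom_mult)
  moreover have "?b \<noteq> 0" using ab(2) ev(2) by auto
  ultimately have "Fract (complex_mpoly p) (complex_mpoly q) = Fract ?a ?b"
    using b by (simp add: eq_fract)
  then show ?thesis
    unfolding ratfun_value_def using ab ev by (intro exI[of _ ?a] exI[of _ ?b]) auto
qed

section \<open>Functions that are polynomial on complex lines\<close>

text \<open>
  Polynomials in several variables are used only through their restrictions to lines, where the
  theory of univariate polynomials applies. Unlike the polynomials themselves, these functions need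
  no algebra of exponents when coordinates are substituted.
\<close>

definition line_poly :: "('a::field_char_0 ^ 'd \<Rightarrow> 'a) \<Rightarrow> bool" where
  "line_poly F \<longleftrightarrow> (\<forall>a b. \<exists>r. \<forall>t. F (a + t *s b) = poly r t)"

lemma line_polyE:
  assumes "line_poly F"
  obtains r where "\<And>t. F (a + t *s b) = poly r t"
  using assms unfolding line_poly_def by blast

lemma line_poly_const [intro]: "line_poly (\<lambda>z. c)"
  unfolding line_poly_def by (auto intro: exI[of _ "[:c:]"])

lemma line_poly_nth [intro]: "line_poly (\<lambda>z. z $ k)"
  unfolding line_poly_def
proof (intro allI)
  fix a b :: "'a ^ 'b"
  show "\<exists>r. \<forall>t. (a + t *s b) $ k = poly r t"
    by (intro exI[of _ "[:a $ k, b $ k:]"]) simp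
qed

lemma line_poly_add [intro]:
  assumes "line_poly F" "line_poly G"
  shows "line_poly (\<lambda>z. F z + G z)"
  using assms unfolding line_poly_def by (metis poly_add)

lemma line_poly_diff [intro]:
  assumes "line_poly F" "line_poly G"
  shows "line_poly (\<lambda>z. F z - G z)"
  using assms unfolding line_poly_def by (metis poly_diff)

lemma line_poly_mult [intro]:
  assumes "line_poly F" "line_poly G"
  shows "line_poly (\<lambda>z. F z * G z)"
  using assms unfolding line_poly_def by (metis poly_mult)

lemma line_poly_sum [intro]: "(\<And>i. i \<in> I \<Longrightarrow> line_poly (F i)) \<Longrightarrow> line_poly (\<lambda>z. \<Sum>i\<in>I. F i z)"
  by (induction I rule: infinite_finite_induct) auto

lemma line_poly_prod [intro]: "(\<And>i. i \<in> I \<Longrightarrow> line_poly (F i)) \<Longrightarrow> line_poly (\<lambda>z. \<Prod>i\<in>I. F i z)"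
  by (induction I rule: infinite_finite_induct) auto

lemma line_poly_power [intro]: "line_poly F \<Longrightarrow> line_poly (\<lambda>z. F z ^ n)"
  by (induction n) auto

lemma line_poly_mpoly_eval [intro]: "line_poly (mpoly_eval p)"
  unfolding mpoly_eval_def by (intro line_poly_sum line_poly_mult line_poly_prod line_poly_power line_poly_const line_poly_nth)

lemma line_poly_compose:
  assumes F: "line_poly F" and \<sigma>: "\<And>a b t. \<sigma> (a + t *s b) = \<sigma> a + t *s \<tau> b"
  shows "line_poly (\<lambda>z. F (\<sigma> z))"
  using F unfolding line_poly_def \<sigma> by blast

lemma line_poly_upd [intro]:
  assumes "line_poly F"
  shows "line_poly (\<lambda>z. F (upd z k w))"
  using assms
  by (rule line_poly_compose[where \<tau> = "\<lambda>b. upd b k 0"]) (auto simp: vec_eq_iff upd_nth)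

text \<open>The integral-domain property passes from univariate polynomials to these functions.\<close>

lemma line_poly_no_zero_divisors:
  assumes "line_poly F" "line_poly G" "\<And>z. F z * G z = 0" "F x \<noteq> 0"
  shows "G z = 0"
proof -
  obtain r where r: "\<And>t. F (z + t *s (x - z)) = poly r t" using line_polyE[OF assms(1)] by blast
  obtain s where s: "\<And>t. G (z + t *s (x - z)) = poly s t" using line_polyE[OF assms(2)] by blast
  have "poly (r * s) t = 0" for t using assms(3)[of "z + t *s (x - z)"] r s by simp
  then have "r * s = 0" using poly_all_0_iff_0 by blast
  moreover have "r \<noteq> 0" using r[of 1] assms(4) by auto
  ultimately have "s = 0" by simp
  then show ?thesis using s[of 0] by simp
qed

lemma poly_eventually_0:
  fixes r :: "complex poly"
  assumes "\<forall>\<^sub>F t in nhds 0. poly r t = 0"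
  shows "r = 0"
proof (rule ccontr)
  assume "r \<noteq> 0"
  then have fin: "finite {t. poly r t = 0}" by (rule poly_roots_finite)
  obtain S where S: "open S" "0 \<in> S" "\<And>t. t \<in> S \<Longrightarrow> poly r t = 0"
    using assms unfolding eventually_nhds by blast
  then have "finite S" using finite_subset[OF _ fin] by blast
  then show False using S(1,2) finite_imp_not_open[of S] by blast
qed

section \<open>Real multiaffine functions and the upper poly-half-plane\<close>

definition upper_polyhalfplane :: "(complex ^ 'd) set" where
  "upper_polyhalfplane = {z. \<forall>k. 0 < Im (z $ k)}"

definition real_point :: "complex ^ 'd \<Rightarrow> bool" where
  "real_point z \<longleftrightarrow> (\<forall>k. Im (z $ k) = 0)"

text \<open>
  The conjugation symmetry expresses that the coefficients are real.
\<close>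

definition real_multiaffine :: "(complex ^ 'd \<Rightarrow> complex) \<Rightarrow> bool" where
  "real_multiaffine p \<longleftrightarrow>
     (\<forall>z. p (\<chi> k. cnj (z $ k)) = cnj (p z)) \<and>
     (\<forall>k z w. p (upd z k w) = p (upd z k 0) + w * (p (upd z k 1) - p (upd z k 0))) \<and>
     line_poly p"

text \<open>
  For functions that are affine in the coordinate \<open>k\<close> this is the Wronskian \<open>q \<partial>\<^sub>k p - p \<partial>\<^sub>k q\<close>; the
  formula shows that it does not depend on the coordinate \<open>k\<close> of \<open>z\<close>.
\<close>

definition wronski :: "('a::comm_ring_1 ^ 'd \<Rightarrow> 'a) \<Rightarrow> ('a ^ 'd \<Rightarrow> 'a) \<Rightarrow> 'd \<Rightarrow> 'a ^ 'd \<Rightarrow> 'a" where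
  "wronski q p k z = q (upd z k 0) * p (upd z k 1) - p (upd z k 0) * q (upd z k 1)"

lemma real_multiaffine_affine:
  assumes "real_multiaffine p"
  shows "p (upd z k w) = p (upd z k 0) + w * (p (upd z k 1) - p (upd z k 0))"
  using assms unfolding real_multiaffine_def by blast

lemma real_multiaffine_line_poly: "real_multiaffine p \<Longrightarrow> line_poly p"
  unfolding real_multiaffine_def by blast

lemma real_multiaffine_real:
  assumes "real_multiaffine p" "real_point z"
  shows "Im (p z) = 0"
proof -
  have "(\<chi> k. cnj (z $ k)) = z"
    using assms(2) by (simp add: real_point_def vec_eq_iff complex_eq_iff)
  then have "p z = cnj (p z)"
    using assms(1) unfolding real_multiaffine_def by metis
  then show ?thesis by (simp add: complex_eq_iff)
qed

lemma line_poly_wronski [intro]: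
  assumes "line_poly q" "line_poly p"
  shows "line_poly (wronski q p k)"
  unfolding wronski_def by (intro line_poly_diff line_poly_mult line_poly_upd assms)

lemma real_quadratic_nonneg:
  fixes N M I :: real
  assumes "\<And>s. 0 \<le> N + s * M + s\<^sup>2 * I"
  shows "0 \<le> I" and "M\<^sup>2 \<le> 4 * I * N"
proof -
  show I: "0 \<le> I"
  proof (rule ccontr)
    assume "\<not> 0 \<le> I"
    define s where "s = 1 + (\<bar>N\<bar> + 1) / (- I)"
    have "0 \<le> (\<bar>N\<bar> + 1) / (- I)" using \<open>\<not> 0 \<le> I\<close> by (intro divide_nonneg_pos) auto
    then have "s \<ge> 1" "s * (- I) \<ge> \<bar>N\<bar> + 1"
      using \<open>\<not> 0 \<le> I\<close> by (auto simp: s_def field_simps)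
    then have "s\<^sup>2 * (- I) \<ge> s * (- I)"
      using \<open>\<not> 0 \<le> I\<close> by (intro mult_right_mono) (auto simp: power2_eq_square)
    moreover have "0 \<le> N + s\<^sup>2 * I" using assms[of s] assms[of "- s"] by simp
    ultimately show False using \<open>s * (- I) \<ge> \<bar>N\<bar> + 1\<close> by linarith
  qed
  show "M\<^sup>2 \<le> 4 * I * N"
  proof (cases "I = 0")
    case True
    have "M = 0"
    proof (rule ccontr)
      assume "M \<noteq> 0"
      then show False using assms[of "- (N + 1) / M"] True by simp
    qed
    then show ?thesis using True by simp
  next
    case False
    then have "0 \<le> 4 * I * (N + (- M / (2 * I)) * M + (- M / (2 * I))\<^sup>2 * I)"
      using I by (intro mult_nonneg_nonneg assms) auto
    also have "\<dots> = 4 * I * N - M\<^sup>2"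
      using False by (simp add: field_simps power2_eq_square)
    finally show ?thesis by simp
  qed
qed

text \<open>
  If the Moebius transformation \<open>w \<mapsto> (a + w b) / (c + w e)\<close> maps the real line into the closed upper
  half-plane, does it also map the upper half-plane there? Written without division, the question
  makes sense for degenerate transformations too. The discriminant of the quadratic
  \<open>s \<mapsto> Im ((a + s b) cnj (c + s e))\<close> and the real number \<open>Re (b cnj c - a cnj e)\<close>, which
  records the orientation, are tied by \<open>moebius_identity\<close> to the determinant \<open>b c - a e\<close>.
\<close>

lemma moebius_expand:
  "Im ((a + w * b) * cnj (c + w * e)) =
     Im (a * cnj c) + Re w * Im (b * cnj c + a * cnj e) + (Re w)\<^sup>2 * Im (b * cnj e) +
     Im w * Re (b * cnj c - a * cnj e) + (Im w)\<^sup>2 * Im (b * cnj e)"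
  by (simp add: algebra_simps power2_eq_square)

lemma moebius_identity:
  "(Re (b * cnj c - a * cnj e))\<^sup>2 =
     4 * Im (b * cnj e) * Im (a * cnj c) - (Im (b * cnj c + a * cnj e))\<^sup>2 + (cmod (b * c - a * e))\<^sup>2"
  unfolding cmod_power2 by (simp add: algebra_simps power2_eq_square)

lemma moebius_discriminant:
  assumes "\<And>s::real. 0 \<le> Im ((a + of_real s * b) * cnj (c + of_real s * e))"
  shows "0 \<le> Im (b * cnj e)"
    and "(Im (b * cnj c + a * cnj e))\<^sup>2 \<le> 4 * Im (b * cnj e) * Im (a * cnj c)"
proof -
  have "0 \<le> Im (a * cnj c) + s * Im (b * cnj c + a * cnj e) + s\<^sup>2 * Im (b * cnj e)" for s :: real
    using assms[of s] unfolding moebius_expand by simp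
  from real_quadratic_nonneg[OF this]
  show "0 \<le> Im (b * cnj e)"
    and "(Im (b * cnj c + a * cnj e))\<^sup>2 \<le> 4 * Im (b * cnj e) * Im (a * cnj c)" .
qed

text \<open>
  As the real line is mapped into the closed upper half-plane, the quadratic has a discriminant of at
  most zero, and \<open>moebius_identity\<close> bounds the orientation from below by the determinant in absolute
  value.
\<close>

lemma moebius_orientation_nonzero:
  assumes "\<And>s::real. 0 \<le> Im ((a + of_real s * b) * cnj (c + of_real s * e))"
    and "b * c - a * e \<noteq> 0"
  shows "Re (b * cnj c - a * cnj e) \<noteq> 0"
proof
  assume "Re (b * cnj c - a * cnj e) = 0"
  then have "(Re (b * cnj c - a * cnj e))\<^sup>2 = 0" by (simp only: zero_power2)
  then have "(cmod (b * c - a * e))\<^sup>2 \<le> 0"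
    using moebius_identity[of b c a e] moebius_discriminant(2)[OF assms(1)] by linarith
  then show False using assms(2) by simp
qed

text \<open>
  For nonnegative orientation the two terms that distinguish \<open>w\<close> from its real part are nonnegative.
  In the degenerate case of determinant zero the discriminant equals \<open>R\<^sup>2\<close>, and completing the
  squares in the real and the imaginary part of \<open>w\<close> leaves no remainder.
\<close>

lemma moebius_upper:
  assumes real: "\<And>s::real. 0 \<le> Im ((a + of_real s * b) * cnj (c + of_real s * e))"
    and w: "0 < Im w"
    and orient: "b * c - a * e = 0 \<or> 0 \<le> Re (b * cnj c - a * cnj e)"
  shows "0 \<le> Im ((a + w * b) * cnj (c + w * e))"
proof -
  define N M I R where "N = Im (a * cnj c)" and "M = Im (b * cnj c + a * cnj e)"
    and "I = Im (b * cnj e)" and "R = Re (b * cnj c - a * cnj e)"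
  define s t where "s = Re w" and "t = Im w"
  note disc = moebius_discriminant[OF real, folded N_def M_def I_def]
  have quad: "0 \<le> N + s * M + s\<^sup>2 * I"
    using real[of s] unfolding moebius_expand N_def M_def I_def by simp
  have "0 \<le> N + s * M + s\<^sup>2 * I + t * R + t\<^sup>2 * I"
  proof (cases "0 \<le> R")
    case True
    then have "0 \<le> t * R" "0 \<le> t\<^sup>2 * I"
      using w disc(1) by (simp_all add: t_def)
    then show ?thesis using quad by linarith
  next
    case False
    then have "b * c - a * e = 0" using orient by (auto simp: R_def)
    then have R2: "R\<^sup>2 = 4 * I * N - M\<^sup>2"
      using moebius_identity[of b c a e] by (simp add: R_def I_def N_def M_def)
    have "I \<noteq> 0"
    proof
      assume "I = 0"
      then have "R\<^sup>2 \<le> 0" using R2 by simp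
      then show False using False by simp
    qed
    then have I: "0 < I" using disc(1) by simp
    have "4 * I * (N + s * M + s\<^sup>2 * I + t * R + t\<^sup>2 * I) =
        (2 * I * s + M)\<^sup>2 + (2 * I * t + R)\<^sup>2 + (4 * I * N - M\<^sup>2 - R\<^sup>2)"
      by (simp add: power2_eq_square algebra_simps)
    then have "0 \<le> 4 * I * (N + s * M + s\<^sup>2 * I + t * R + t\<^sup>2 * I)"
      using R2 by simp
    then show ?thesis using I by (simp add: zero_le_mult_iff)
  qed
  then show ?thesis
    unfolding moebius_expand N_def M_def I_def R_def s_def t_def .
qed

text \<open>
  The upper half-plane without finitely many points is connected, so a continuous function without
  zeros there keeps the sign that it has near the real axis.
\<close>

lemma orientation_sign:
  fixes R :: "complex \<Rightarrow> real" and r :: "complex poly"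
  assumes cont: "continuous_on UNIV R"
    and upper: "\<And>t. 0 < Im t \<Longrightarrow> poly r t \<noteq> 0 \<Longrightarrow> R t \<noteq> 0"
    and real: "\<And>s::real. poly r (of_real s) \<noteq> 0 \<Longrightarrow> 0 < R (of_real s)"
    and t0: "0 < Im t0" "poly r t0 \<noteq> 0"
  shows "0 < R t0"
proof (rule ccontr)
  assume "\<not> 0 < R t0"
  have "r \<noteq> 0" using t0 by auto
  then have fin: "finite {t. poly r t = 0}" by (rule poly_roots_finite)
  define U where "U = {t. 0 < Im t} - {t. poly r t = 0}"
  have "convex {t. 0 < Im t}" using convex_halfspace_Im_gt[of 0] .
  then have "connected U"
    unfolding U_def using fin
    by (intro connected_open_delete_finite open_halfspace_Im_gt convex_connected) auto
  then have conn: "connected (R ` U)"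
    using cont by (intro connected_continuous_image) (auto intro: continuous_on_subset)
  have "infinite (range complex_of_real)"
    by (simp add: finite_image_iff inj_of_real infinite_UNIV_char_0)
  then obtain s :: real where s: "poly r (of_real s) \<noteq> 0"
    using fin finite_subset[of "range complex_of_real" "{t. poly r t = 0}"] by blast
  have "open {t. 0 < R t}" by (rule open_Collect_less) (auto intro: cont)
  moreover have "open {t. poly r t \<noteq> 0}"
    by (rule open_Collect_neq) (auto intro: continuous_intros)
  ultimately have "open ({t. 0 < R t} \<inter> {t. poly r t \<noteq> 0})" by blast
  moreover have "complex_of_real s \<in> {t. 0 < R t} \<inter> {t. poly r t \<noteq> 0}" using s real by auto
  ultimately obtain e where e: "0 < e" "ball (complex_of_real s) e \<subseteq> {t. 0 < R t} \<inter> {t. poly r t \<noteq> 0}"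
    using open_contains_ball by blast
  define t1 where "t1 = complex_of_real s + of_real (e / 2) * \<i>"
  have "t1 \<in> ball (complex_of_real s) e"
    using e(1) by (simp add: t1_def dist_norm norm_mult)
  then have "t1 \<in> U" "0 < R t1"
    using e by (auto simp: U_def t1_def)
  moreover have "t0 \<in> U" using t0 by (simp add: U_def)
  ultimately have "{R t0..R t1} \<subseteq> R ` U"
    using connected_contains_Icc[OF conn, of "R t0" "R t1"] by blast
  then have "0 \<in> R ` U" using \<open>\<not> 0 < R t0\<close> \<open>0 < R t1\<close> by auto
  then obtain t where "t \<in> U" "R t = 0" by auto
  then show False using upper[of t] by (simp add: U_def)
qed

lemma wronski_eq:
  "wronski q p k z =
     (p (upd z k 1) - p (upd z k 0)) * q (upd z k 0) - p (upd z k 0) * (q (upd z k 1) - q (upd z k 0))"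
  by (simp add: wronski_def algebra_simps)

text \<open>
  The set \<open>S\<close> contains the coordinates that have left the real line. In the induction step the new
  coordinate enters \<open>p/q\<close> through a Moebius transformation with coefficients \<open>A\<close>, \<open>B\<close>, \<open>C\<close>, \<open>E\<close> that
  depend on the other coordinates. The induction hypothesis says that it maps the real line into
  the closed upper half-plane.
\<close>

lemma wronskian_nonneg_imp_upper_partial:
  fixes p q :: "complex ^ 'd \<Rightarrow> complex"
  assumes p: "real_multiaffine p" and q: "real_multiaffine q"
    and W: "\<And>k z. real_point z \<Longrightarrow> 0 \<le> Re (wronski q p k z)"
    and "finite S"
  shows "(\<And>j. j \<in> S \<Longrightarrow> 0 < Im (z $ j)) \<Longrightarrow> (\<And>j. j \<notin> S \<Longrightarrow> Im (z $ j) = 0) \<Longrightarrow>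
    0 \<le> Im (p z * cnj (q z))"
  using \<open>finite S\<close>
proof (induction S arbitrary: z rule: finite_induct)
  case empty
  then have "real_point z" by (simp add: real_point_def)
  then show ?case using p q by (simp add: real_multiaffine_real)
next
  case (insert k S)
  define A B C E where "A = (\<lambda>y. p (upd y k 0))" and "B = (\<lambda>y. p (upd y k 1) - p (upd y k 0))"
    and "C = (\<lambda>y. q (upd y k 0))" and "E = (\<lambda>y. q (upd y k 1) - q (upd y k 0))"
  define R where "R = (\<lambda>y. Re (B y * cnj (C y) - A y * cnj (E y)))"
  have wr: "wronski q p k y = B y * C y - A y * E y" for y
    by (simp add: wronski_eq A_def B_def C_def E_def)
  have p_upd: "p (upd y k w) = A y + w * B y" for y w
    using real_multiaffine_affine[OF p, of y k w] by (simp add: A_def B_def)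
  have q_upd: "q (upd y k w) = C y + w * E y" for y w
    using real_multiaffine_affine[OF q, of y k w] by (simp add: C_def E_def)
  \<comment> \<open>The point \<open>Z \<i>\<close> has the coordinates of \<open>z\<close> outside \<open>k\<close>, the points \<open>Z t\<close> with real \<open>t\<close> are
    real, and \<open>Z t\<close> has the same coordinates in the upper half-plane as \<open>z\<close> if \<open>Im t > 0\<close>.\<close>
  define a0 b0 :: "complex ^ 'd" where "a0 = (\<chi> j. of_real (Re (z $ j)))"
    and "b0 = (\<chi> j. if j \<in> S then of_real (Im (z $ j)) else 0)"
  define Z where "Z t = a0 + t *s b0" for t
  have Z_Re: "Re (Z t $ j) = Re (z $ j) + (if j \<in> S then Re t * Im (z $ j) else 0)" for t j
    by (simp add: Z_def a0_def b0_def)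
  have Z_Im: "Im (Z t $ j) = (if j \<in> S then Im t * Im (z $ j) else 0)" for t j
    by (simp add: Z_def a0_def b0_def)
  have Z_i: "upd (Z \<i>) k w = upd z k w" for w
    using insert.prems by (auto simp: vec_eq_iff upd_nth complex_eq_iff Z_Re Z_Im)
  have ABCE_i: "A (Z \<i>) = A z" "B (Z \<i>) = B z" "C (Z \<i>) = C z" "E (Z \<i>) = E z"
    by (simp_all add: A_def B_def C_def E_def Z_i)
  have bracket: "0 \<le> Im ((A (Z t) + of_real s * B (Z t)) * cnj (C (Z t) + of_real s * E (Z t)))"
    if "0 < Im t" for t and s :: real
  proof -
    have "0 \<le> Im (p (upd (Z t) k (of_real s)) * cnj (q (upd (Z t) k (of_real s))))"
      using that insert by (intro insert.IH) (auto simp: upd_nth Z_Im)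
    then show ?thesis unfolding p_upd q_upd .
  qed
  have lp: "line_poly p" "line_poly q" using p q by (auto dest: real_multiaffine_line_poly)
  have lps: "line_poly A" "line_poly B" "line_poly C" "line_poly E"
    unfolding A_def B_def C_def E_def by (intro line_poly_diff line_poly_upd lp)+
  have cont: "continuous_on UNIV (\<lambda>t. F (Z t))" if F: "line_poly F" for F
  proof -
    obtain r where "\<And>t. F (a0 + t *s b0) = poly r t" using line_polyE[OF F] by blast
    then have "(\<lambda>t. F (Z t)) = (\<lambda>t. poly r t)" by (simp only: Z_def)
    then show ?thesis by (simp only: continuous_on_poly[OF continuous_on_id])
  qed
  note conts = cont[OF lps(1)] cont[OF lps(2)] cont[OF lps(3)] cont[OF lps(4)]
  obtain r where r: "\<And>t. wronski q p k (Z t) = poly r t"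
    using line_polyE[OF line_poly_wronski[OF lp(2,1)], of k a0 b0] unfolding Z_def by blast
  have "wronski q p k (Z \<i>) = 0 \<or> 0 < R (Z \<i>)"
  proof (cases "poly r \<i> = 0")
    case False
    have "0 < R (Z \<i>)"
    proof (rule orientation_sign[where r = r and R = "\<lambda>t. R (Z t)"])
      show "continuous_on UNIV (\<lambda>t. R (Z t))"
        unfolding R_def by (intro continuous_intros conts)
      show "R (Z t) \<noteq> 0" if "0 < Im t" "poly r t \<noteq> 0" for t
        unfolding R_def
      proof (rule moebius_orientation_nonzero)
        show "B (Z t) * C (Z t) - A (Z t) * E (Z t) \<noteq> 0" using that(2) r[of t] wr by simp
      qed (rule bracket[OF that(1)])
      show "0 < R (Z (of_real s))" if s: "poly r (of_real s) \<noteq> 0" for s :: real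
      proof -
        let ?y = "Z (of_real s)"
        have y: "real_point ?y" by (simp add: real_point_def Z_Im)
        then have yu: "real_point (upd ?y k (of_real x))" for x
          by (simp add: real_point_def upd_nth)
        have "real_point (upd ?y k 0)" "real_point (upd ?y k 1)"
          using yu[of 0] yu[of 1] by simp_all
        then have im: "Im (A ?y) = 0" "Im (B ?y) = 0" "Im (C ?y) = 0" "Im (E ?y) = 0"
          by (simp_all add: A_def B_def C_def E_def real_multiaffine_real p q)
        then have "R ?y = Re (wronski q p k ?y)" "Im (wronski q p k ?y) = 0"
          by (simp_all add: R_def wr)
        moreover have "wronski q p k ?y \<noteq> 0" using s r by simp
        ultimately show ?thesis using W[OF y, of k] by (auto simp: complex_eq_iff)
      qed
    qed (use False in auto)
    then show ?thesis ..
  qed (use r in auto)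
  have "0 \<le> Im ((A z + z $ k * B z) * cnj (C z + z $ k * E z))"
  proof (rule moebius_upper)
    show "0 \<le> Im ((A z + of_real s * B z) * cnj (C z + of_real s * E z))" for s :: real
      using bracket[of \<i> s] unfolding ABCE_i by simp
    show "0 < Im (z $ k)" by (rule insert.prems(1)) simp
    have "wronski q p k (Z \<i>) = B z * C z - A z * E z" using wr ABCE_i by simp
    moreover have "R (Z \<i>) = R z" by (simp only: R_def ABCE_i)
    ultimately have "B z * C z - A z * E z = 0 \<or> 0 \<le> R z"
      using \<open>wronski q p k (Z \<i>) = 0 \<or> 0 < R (Z \<i>)\<close> by auto
    then show "B z * C z - A z * E z = 0 \<or> 0 \<le> Re (B z * cnj (C z) - A z * cnj (E z))"
      by (simp only: R_def)
  qed
  then show ?case using p_upd[of z "z $ k"] q_upd[of z "z $ k"] by simp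
qed

lemma wronskian_nonneg_imp_upper:
  fixes p q :: "complex ^ 'd::finite \<Rightarrow> complex"
  assumes "real_multiaffine p" "real_multiaffine q"
    and "\<And>k z. real_point z \<Longrightarrow> 0 \<le> Re (wronski q p k z)"
    and "z \<in> upper_polyhalfplane"
  shows "0 \<le> Im (p z * cnj (q z))"
  using assms(4)
  by (intro wronskian_nonneg_imp_upper_partial[OF assms(1-3), of UNIV])
    (auto simp: upper_polyhalfplane_def)

section \<open>Zeros of the denominator\<close>

text \<open>
  If \<open>p\<close> did not vanish, then near this simple zero of \<open>q\<close> in the direction \<open>k\<close> the quotient \<open>p/q\<close>
  would take all values near infinity, also those in the lower half-plane.
\<close>

lemma simple_zero_common:
  assumes p: "real_multiaffine p" and q: "real_multiaffine q"
    and pos: "\<And>z. z \<in> upper_polyhalfplane \<Longrightarrow> 0 \<le> Im (p z * cnj (q z))"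
    and u: "u \<in> upper_polyhalfplane" "q u = 0" "q (upd u k 1) \<noteq> q (upd u k 0)"
  shows "p u = 0"
proof (rule ccontr)
  assume pu: "p u \<noteq> 0"
  define b e where "b = p (upd u k 1) - p (upd u k 0)" and "e = q (upd u k 1) - q (upd u k 0)"
  have e: "e \<noteq> 0" using u by (simp add: e_def)
  have p_eq: "p (upd u k (u $ k + s)) = p u + s * b" for s
  proof -
    have "p (upd u k (u $ k + s)) = p (upd u k 0) + (u $ k + s) * b"
      "p u = p (upd u k 0) + u $ k * b"
      unfolding b_def
      using real_multiaffine_affine[OF p, of u k "u $ k + s"]
        real_multiaffine_affine[OF p, of u k "u $ k", unfolded upd_same] .
    then show ?thesis by (simp only: distrib_right add.assoc)
  qed
  have q_eq: "q (upd u k (u $ k + s)) = s * e" for s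
  proof -
    have "q (upd u k (u $ k + s)) = q (upd u k 0) + (u $ k + s) * e"
      "q u = q (upd u k 0) + u $ k * e"
      unfolding e_def
      using real_multiaffine_affine[OF q, of u k "u $ k + s"]
        real_multiaffine_affine[OF q, of u k "u $ k", unfolded upd_same] .
    then have "q (upd u k (u $ k + s)) = q u + s * e" by (simp only: distrib_right add.assoc)
    then show ?thesis using u(2) by simp
  qed
  \<comment> \<open>In this direction \<open>p cnj q\<close> is to first order a negative multiple of \<open>\<i>\<close>.\<close>
  define d where "d = \<i> * p u / e"
  have de: "d * e = \<i> * p u" using e by (simp add: d_def)
  have val: "Im ((p u + of_real t * d * b) * cnj (of_real t * d * e)) =
      t * (t * Im (d * b * cnj (d * e)) - (cmod (p u))\<^sup>2)" for t
  proof -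
    have "(p u + of_real t * d * b) * cnj (of_real t * d * e) =
        of_real t * (p u * cnj (d * e) + of_real t * (d * b * cnj (d * e)))"
      by (simp add: algebra_simps)
    moreover have "Im (p u * cnj (d * e)) = - (cmod (p u))\<^sup>2"
      unfolding de cmod_power2 by (simp add: power2_eq_square)
    moreover have "Im (of_real t * (X + of_real t * Y)) = t * (t * Im Y + Im X)" for X Y
      by simp
    ultimately show ?thesis by (simp only: minus_add_distrib) (simp only: add_uminus_conv_diff)
  qed
  have "((\<lambda>t::real. Im (u $ k + of_real t * d)) \<longlongrightarrow> Im (u $ k + of_real 0 * d)) (at_right 0)"
    by (intro tendsto_intros)
  moreover have "0 < Im (u $ k + of_real 0 * d)"
    using u(1) by (simp add: upper_polyhalfplane_def)
  ultimately have "\<forall>\<^sub>F t::real in at_right 0. 0 < Im (u $ k + of_real t * d)"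
    by (rule order_tendstoD(1))
  moreover have "((\<lambda>t::real. t * Im (d * b * cnj (d * e)) - (cmod (p u))\<^sup>2) \<longlongrightarrow>
      0 * Im (d * b * cnj (d * e)) - (cmod (p u))\<^sup>2) (at_right 0)"
    by (intro tendsto_intros)
  then have "\<forall>\<^sub>F t::real in at_right 0. t * Im (d * b * cnj (d * e)) - (cmod (p u))\<^sup>2 < 0"
    by (rule order_tendstoD(2)) (use pu in simp)
  moreover have "\<forall>\<^sub>F t::real in at_right 0. 0 < t"
    by (rule eventually_at_right_less)
  ultimately have "\<forall>\<^sub>F t::real in at_right 0. 0 < Im (u $ k + of_real t * d) \<and>
      t * Im (d * b * cnj (d * e)) - (cmod (p u))\<^sup>2 < 0 \<and> 0 < t"
    by eventually_elim blast
  then obtain t :: real where t: "0 < Im (u $ k + of_real t * d)"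
      "t * Im (d * b * cnj (d * e)) - (cmod (p u))\<^sup>2 < 0" "0 < t"
    using eventually_happens' trivial_limit_at_right_real by blast
  have "upd u k (u $ k + of_real t * d) \<in> upper_polyhalfplane"
    using u(1) t(1) by (auto simp: upper_polyhalfplane_def upd_nth)
  from pos[OF this] have "0 \<le> t * (t * Im (d * b * cnj (d * e)) - (cmod (p u))\<^sup>2)"
    unfolding p_eq q_eq val .
  then show False using t(2,3) by (simp add: zero_le_mult_iff)
qed

lemma isCont_eventually_pos:
  fixes f :: "'a::t2_space \<Rightarrow> real"
  assumes "isCont f x" "0 < f x"
  shows "\<forall>\<^sub>F y in nhds x. 0 < f y"
  using order_tendstoD(1)[of f "f x" "nhds x" 0] assms
  unfolding isCont_def tendsto_at_iff_tendsto_nhds by blast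

text \<open>
  Such a zero of \<open>q\<close> is simple in the direction \<open>k\<close>, so it moves continuously with the other
  coordinates. At all these zeros \<open>p\<close> vanishes too, so the two affine functions of \<open>z\<^sub>k\<close> are
  proportional for all values of the other coordinates near those of \<open>u\<close>, and hence for all values.
\<close>

lemma wronski_vanishes:
  fixes p q :: "complex ^ 'd::finite \<Rightarrow> complex"
  assumes p: "real_multiaffine p" and q: "real_multiaffine q"
    and pos: "\<And>z. z \<in> upper_polyhalfplane \<Longrightarrow> 0 \<le> Im (p z * cnj (q z))"
    and u: "u \<in> upper_polyhalfplane" "q u = 0" "q (upd u k w) \<noteq> 0"
  shows "wronski q p k x = 0"
proof -
  define C E where "C = (\<lambda>y. q (upd y k 0))" and "E = (\<lambda>y. q (upd y k 1) - q (upd y k 0))"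
  have q_upd: "q (upd y k s) = C y + s * E y" for y s
    using real_multiaffine_affine[OF q, of y k s] by (simp add: C_def E_def)
  have Cu: "C u + u $ k * E u = 0" using q_upd[of u "u $ k"] u(2) by simp
  have Eu: "E u \<noteq> 0"
  proof
    assume "E u = 0"
    then show False using Cu u(3) q_upd[of u w] by simp
  qed
  have lp: "line_poly p" "line_poly q" using p q by (auto dest: real_multiaffine_line_poly)
  have "line_poly C" "line_poly E"
    unfolding C_def E_def by (intro line_poly_diff line_poly_upd lp)+
  define L where "L t = u + t *s (x - u)" for t
  obtain rC where rC: "\<And>t. C (L t) = poly rC t"
    unfolding L_def using line_polyE[OF \<open>line_poly C\<close>] by metis
  obtain rE where rE: "\<And>t. E (L t) = poly rE t"
    unfolding L_def using line_polyE[OF \<open>line_poly E\<close>] by metis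
  obtain r where r: "\<And>t. wronski q p k (L t) = poly r t"
    unfolding L_def using line_polyE[OF line_poly_wronski[OF lp(2,1)]] by metis
  have L0: "L 0 = u" by (simp add: L_def)
  have rE0: "poly rE 0 \<noteq> 0" using rE[of 0] Eu L0 by simp
  have root0: "- (poly rC 0 / poly rE 0) = u $ k"
    using Cu Eu rC[of 0] rE[of 0] L0 by (simp add: field_simps add_eq_0_iff)
  have "\<forall>\<^sub>F t in nhds 0. poly rE t \<noteq> 0"
    using rE0 by (intro eventually_nhds_in_open[of "{t. poly rE t \<noteq> 0}", simplified] open_Collect_neq continuous_intros)
  moreover have "isCont (\<lambda>t. Im (- (poly rC t / poly rE t))) 0"
    by (intro isCont_Im isCont_minus isCont_divide poly_isCont rE0)
  then have "\<forall>\<^sub>F t in nhds 0. 0 < Im (- (poly rC t / poly rE t))"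
    by (rule isCont_eventually_pos) (use root0 u(1) in \<open>simp add: upper_polyhalfplane_def\<close>)
  moreover have "\<forall>\<^sub>F t in nhds 0. \<forall>j. 0 < Im (L t $ j)"
  proof (rule eventually_all_finite)
    fix j
    have "isCont (\<lambda>t. Im (L t $ j)) 0" 
      unfolding L_def vector_add_component vector_smult_component by (intro isCont_Im continuous_intros)
    then show "\<forall>\<^sub>F t in nhds 0. 0 < Im (L t $ j)"
      by (rule isCont_eventually_pos) (use L0 u(1) in \<open>simp add: upper_polyhalfplane_def\<close>)
  qed
  ultimately have "\<forall>\<^sub>F t in nhds 0. poly r t = 0"
  proof eventually_elim
    case (elim t)
    define y v where "y = L t" and "v = - (C y / E y)"
    have Ey: "E y \<noteq> 0" using elim(1) rE by (simp add: y_def)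
    have v: "0 < Im v" using elim(2) rC rE by (simp add: y_def v_def)
    have "p (upd y k v) = 0"
    proof (rule simple_zero_common[OF p q pos, of _ k])
      show "upd y k v \<in> upper_polyhalfplane"
        using v elim(3) by (auto simp: upper_polyhalfplane_def upd_nth y_def)
      show "q (upd y k v) = 0" using q_upd[of y v] Ey by (simp add: v_def)
      show "q (upd (upd y k v) k 1) \<noteq> q (upd (upd y k v) k 0)"
        using Ey by (simp add: E_def)
    qed
    then have "p (upd y k 0) = - (v * (p (upd y k 1) - p (upd y k 0)))"
      using real_multiaffine_affine[OF p, of y k v] unfolding eq_neg_iff_add_eq_0 by argo
    moreover have "C y = - (v * E y)"
      using Ey by (simp add: v_def)
    then have "q (upd y k 0) = - (v * (q (upd y k 1) - q (upd y k 0)))"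
      by (simp only: C_def E_def)
    moreover have "b * c - a * e = 0" if "a = - (v * b)" "c = - (v * e)" for a b c e :: complex
      using that by simp
    ultimately have "wronski q p k y = 0"
      unfolding wronski_eq by blast
    then show ?case using r[of t] by (simp add: y_def)
  qed
  then have "r = 0" by (rule poly_eventually_0)
  then show ?thesis using r[of 1] by (simp add: L_def)
qed

text \<open>
  Changing the coordinates of \<open>u\<close> into those of \<open>v\<close> one by one, there is a first step at which \<open>q\<close>
  becomes nonzero.
\<close>

lemma walk_to_nonzero:
  fixes q :: "complex ^ 'd::finite \<Rightarrow> complex"
  assumes u: "u \<in> upper_polyhalfplane" "q u = 0" and v: "v \<in> upper_polyhalfplane" "q v \<noteq> 0"
  obtains u' k w where "u' \<in> upper_polyhalfplane" "q u' = 0" "q (upd u' k w) \<noteq> 0"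
proof (rule ccontr)
  assume none: "\<not> thesis"
  note found = that
  define m where "m S = (\<chi> j. if j \<in> S then v $ j else u $ j)" for S
  have m_upper: "m S \<in> upper_polyhalfplane" for S
    using u v by (auto simp: m_def upper_polyhalfplane_def)
  have "q (m S) = 0" if "finite S" for S
    using that
  proof induction
    case empty
    then show ?case using u by (simp add: m_def)
  next
    case (insert k S)
    have "m (insert k S) = upd (m S) k (v $ k)"
      by (auto simp: m_def vec_eq_iff upd_nth)
    then show ?case using none found[OF m_upper insert.IH] by metis
  qed
  from this[of UNIV] show False using v by (simp add: m_def)
qed

lemma nonzero_in_upper:
  fixes q :: "complex ^ 'd::finite \<Rightarrow> complex"
  assumes "line_poly q" "q x \<noteq> 0"
  obtains v where "v \<in> upper_polyhalfplane" "q v \<noteq> 0"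
proof -
  obtain r where r: "\<And>t. q (x + t *s (\<chi> j. \<i>)) = poly r t" using line_polyE[OF assms(1)] by blast
  have "x + 0 *s (\<chi> j. \<i>) = x" by (simp add: vec_eq_iff)
  then have "r \<noteq> 0" using r[of 0] assms(2) by auto
  then have fin: "finite {t. poly r t = 0}" by (rule poly_roots_finite)
  define B where "B = (\<Sum>j\<in>UNIV. \<bar>Im (x $ j)\<bar>)"
  have "infinite (complex_of_real ` {B<..})"
    by (simp add: finite_image_iff inj_on_def infinite_Ioi)
  then obtain t where t: "B < t" "poly r (of_real t) \<noteq> 0"
    using fin finite_subset[of "complex_of_real ` {B<..}" "{t. poly r t = 0}"] by blast
  show thesis
  proof (rule that)
    show "q (x + of_real t *s (\<chi> j. \<i>)) \<noteq> 0" using r t by simp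
    have "\<bar>Im (x $ j)\<bar> \<le> B" for j
      unfolding B_def by (intro member_le_sum) auto
    then have "0 < Im (x $ j) + t" for j using t(1) by (smt (verit))
    then show "x + of_real t *s (\<chi> j. \<i>) \<in> upper_polyhalfplane"
      by (simp add: upper_polyhalfplane_def)
  qed
qed

definition substitute :: "'d set \<Rightarrow> 'a ^ 'd \<Rightarrow> 'a ^ 'd \<Rightarrow> 'a ^ 'd" where
  "substitute K x z = (\<chi> k. if k \<in> K then x $ k else z $ k)"

lemma substitute_nth: "substitute K x z $ k = (if k \<in> K then x $ k else z $ k)"
  by (simp add: substitute_def)

lemma substitute_upd:
  "substitute K x (upd z k w) = (if k \<in> K then substitute K x z else upd (substitute K x z) k w)"
  by (auto simp: vec_eq_iff substitute_nth upd_nth)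

lemma line_poly_substitute [intro]:
  assumes "line_poly F"
  shows "line_poly (\<lambda>z. F (substitute K x z))"
  using assms
  by (rule line_poly_compose[where \<tau> = "substitute K 0"]) (auto simp: vec_eq_iff substitute_nth)

lemma real_multiaffine_substitute:
  assumes p: "real_multiaffine p" and x: "real_point x"
  shows "real_multiaffine (\<lambda>z. p (substitute K x z))"
  unfolding real_multiaffine_def
proof (intro conjI allI)
  fix z
  have "substitute K x (\<chi> k. cnj (z $ k)) = (\<chi> k. cnj (substitute K x z $ k))"
    using x by (auto simp: vec_eq_iff substitute_nth real_point_def complex_eq_iff)
  then show "p (substitute K x (\<chi> k. cnj (z $ k))) = cnj (p (substitute K x z))"
    using p unfolding real_multiaffine_def by simp
next
  fix k z w
  show "p (substitute K x (upd z k w)) = p (substitute K x (upd z k 0)) +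
      w * (p (substitute K x (upd z k 1)) - p (substitute K x (upd z k 0)))"
    using real_multiaffine_affine[OF p, of "substitute K x z" k w] by (auto simp: substitute_upd)
next
  show "line_poly (\<lambda>z. p (substitute K x z))"
    using p by (auto dest: real_multiaffine_line_poly)
qed

lemma wronski_substitute:
  "wronski (\<lambda>z. q (substitute K x z)) (\<lambda>z. p (substitute K x z)) k z =
     (if k \<in> K then 0 else wronski q p k (substitute K x z))"
  by (simp add: wronski_def substitute_upd)

text \<open>
  The set \<open>K\<close> is chosen as large as possible among the sets of coordinates for which real numbers
  can be substituted without changing any of the quotients \<open>p\<^sub>i/q\<close>. A zero of the denominator in the
  upper poly-half-plane would yield a coordinate outside \<open>K\<close> on which no quotient depends.
  The family is needed because the entries of a matrix must share one substitution.
\<close>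

lemma denominator_free_of_zeros:
  fixes q :: "complex ^ 'd::finite \<Rightarrow> complex" and p :: "'i \<Rightarrow> complex ^ 'd \<Rightarrow> complex"
  assumes q: "real_multiaffine q" and p: "\<And>i. real_multiaffine (p i)"
    and W: "\<And>i k z. real_point z \<Longrightarrow> 0 \<le> Re (wronski q (p i) k z)"
    and nz: "q z0 \<noteq> 0"
  obtains K x where "real_point x"
    and "\<And>z. z \<in> upper_polyhalfplane \<Longrightarrow> q (substitute K x z) \<noteq> 0"
    and "\<And>i z. p i z * q (substitute K x z) = p i (substitute K x z) * q z"
proof -
  define G where "G K x \<longleftrightarrow> real_point x \<and> (\<exists>z. q (substitute K x z) \<noteq> 0) \<and>
    (\<forall>i z. p i z * q (substitute K x z) = p i (substitute K x z) * q z)" for K x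
  have "G {} 0" using nz by (auto simp: G_def real_point_def substitute_def)
  then have "\<exists>K. (\<exists>x. G K x) \<and> (\<forall>K'. (\<exists>x. G K' x) \<longrightarrow> card K' \<le> card K)"
    by (intro ex_has_greatest_nat[where b = "Suc CARD('d)" and k = "{}"])
      (auto simp: less_Suc_eq_le intro: card_mono)
  then obtain K x where Kx: "G K x" and max: "\<And>K' x'. G K' x' \<Longrightarrow> card K' \<le> card K"
    by blast
  define qs where "qs = (\<lambda>z. q (substitute K x z))"
  define ps where "ps i = (\<lambda>z. p i (substitute K x z))" for i
  have x: "real_point x" using Kx by (simp add: G_def)
  obtain z1 where z1: "qs z1 \<noteq> 0" using Kx by (auto simp: G_def qs_def)
  have eq: "p i z * qs z = ps i z * q z" for i z using Kx by (simp add: G_def qs_def ps_def)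
  have qs: "real_multiaffine qs" and ps: "real_multiaffine (ps i)" for i
    unfolding qs_def ps_def using real_multiaffine_substitute p q x by blast+
  have Ws: "0 \<le> Re (wronski qs (ps i) k z)" if "real_point z" for i k z
  proof -
    have "real_point (substitute K x z)"
      using that x by (simp add: real_point_def substitute_nth)
    then show ?thesis unfolding qs_def ps_def wronski_substitute using W by simp
  qed
  have lp: "line_poly q" "line_poly qs" "line_poly (p i)" "line_poly (ps i)" for i
    using p q ps qs by (auto dest: real_multiaffine_line_poly)
  have "qs z \<noteq> 0" if z: "z \<in> upper_polyhalfplane" for z
  proof
    assume "qs z = 0"
    obtain v where v: "v \<in> upper_polyhalfplane" "qs v \<noteq> 0"
      using nonzero_in_upper[OF lp(2) z1] .
    obtain u k w where u: "u \<in> upper_polyhalfplane" "qs u = 0" "qs (upd u k w) \<noteq> 0"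
      using walk_to_nonzero[OF z \<open>qs z = 0\<close> v] .
    have "k \<notin> K" using u(2,3) by (auto simp: qs_def substitute_upd)
    have W0: "wronski qs (ps i) k y = 0" for i y
      using wronskian_nonneg_imp_upper[OF ps qs Ws] u
      by (intro wronski_vanishes[OF ps qs]) auto
    have "qs (upd u k 0) \<noteq> 0 \<or> qs (upd u k 1) \<noteq> 0"
      using u(3) real_multiaffine_affine[OF qs, of u k w] by auto
    then obtain c where c: "qs (upd u k c) \<noteq> 0" "Im c = 0"
      by (metis one_complex.simps(2) zero_complex.simps(2))
    have sub: "substitute (insert k K) (upd x k c) y = substitute K x (upd y k c)" for y
      using \<open>k \<notin> K\<close> by (auto simp: vec_eq_iff substitute_nth upd_nth)
    have cross: "ps i y * qs (upd y k c) = ps i (upd y k c) * qs y" for i y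
    proof -
      define a b c' e where "a = ps i (upd y k 0)" and "b = ps i (upd y k 1) - ps i (upd y k 0)"
        and "c' = qs (upd y k 0)" and "e = qs (upd y k 1) - qs (upd y k 0)"
      have "b * c' = a * e"
        using W0[of i y] by (simp add: wronski_eq a_def b_def c'_def e_def)
      then have "(a + y $ k * b) * (c' + c * e) = (a + c * b) * (c' + y $ k * e)"
        by algebra
      then show ?thesis
        using real_multiaffine_affine[OF ps, of i y k c] real_multiaffine_affine[OF ps, of i y k "y $ k"]
          real_multiaffine_affine[OF qs, of y k c] real_multiaffine_affine[OF qs, of y k "y $ k"]
        by (simp add: a_def b_def c'_def e_def)
    qed
    have "p i y * qs (upd y k c) = ps i (upd y k c) * q y" for i y
    proof -
      have "qs y' * (p i y' * qs (upd y' k c) - ps i (upd y' k c) * q y') = 0" for y'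
        using eq[of i y'] cross[of i y'] by algebra
      moreover have "line_poly (\<lambda>y. p i y * qs (upd y k c) - ps i (upd y k c) * q y)"
        by (intro line_poly_diff line_poly_mult line_poly_upd lp)
      ultimately have "p i y * qs (upd y k c) - ps i (upd y k c) * q y = 0"
        using line_poly_no_zero_divisors[OF lp(2) _ _ z1] by blast
      then show ?thesis by simp
    qed
    then have "G (insert k K) (upd x k c)"
      unfolding G_def sub using x c
      by (auto simp: real_point_def upd_nth qs_def ps_def)
    from max[OF this] show False using \<open>k \<notin> K\<close> by simp
  qed
  then show thesis
    using eq by (intro that[OF x, of K]) (auto simp: qs_def ps_def)
qed


section \<open>Quadratic forms of matrices\<close>

definition quad :: "complex ^ 'm ^ 'm \<Rightarrow> real ^ 'm \<Rightarrow> complex" where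
  "quad M v = (\<Sum>i\<in>UNIV. \<Sum>j\<in>UNIV. complex_of_real (v $ i * v $ j) * M $ i $ j)"

lemma quad_cmult: "quad (\<chi> i j. c * M $ i $ j) v = c * quad M v"
  unfolding quad_def by (simp add: sum_distrib_left algebra_simps)

lemma quad_diff: "quad M v - quad N v = quad (\<chi> i j. M $ i $ j - N $ i $ j) v"
  unfolding quad_def by (simp add: sum_subtractf algebra_simps)

lemma Re_quad: "Re (quad M v) = (\<Sum>i\<in>UNIV. \<Sum>j\<in>UNIV. v $ i * v $ j * Re (M $ i $ j))"
  by (simp add: quad_def)

text \<open>
  Polarization: identities for the quadratic forms of symmetric matrices pass to the entries.
\<close>

lemma quad_eq_0_imp:
  fixes M :: "complex ^ 'm ^ 'm"
  assumes sym: "\<And>i j. M $ i $ j = M $ j $ i" and 0: "\<And>v. quad M v = 0"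
  shows "M $ i $ j = 0"
proof -
  define \<beta> where "\<beta> v w = (\<Sum>i\<in>UNIV. \<Sum>j\<in>UNIV. complex_of_real (v $ i * w $ j) * M $ i $ j)"
    for v w :: "real ^ 'm"
  have \<beta>_axis: "\<beta> (axis a 1) (axis b 1) = M $ a $ b" for a b
  proof -
    have "complex_of_real (axis a 1 $ i * axis b 1 $ j) * M $ i $ j =
        (if j = b then if i = a then M $ i $ j else 0 else 0)" for i j
      by (simp add: axis_def)
    then show ?thesis unfolding \<beta>_def by simp
  qed
  have "\<beta> (v + w) (v + w) = \<beta> v v + \<beta> v w + \<beta> w v + \<beta> w w" for v w
    unfolding \<beta>_def by (simp add: sum.distrib algebra_simps)
  moreover have "\<beta> v v = 0" for v using 0[of v] by (simp add: \<beta>_def quad_def)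
  ultimately have "\<beta> (axis i 1) (axis j 1) + \<beta> (axis j 1) (axis i 1) = 0" by simp
  then show ?thesis using sym[of i j] by (simp add: \<beta>_axis)
qed

text \<open>
  As \<open>M\<close> is symmetric, \<open>M + M\<^sup>*\<close> is twice its real part, and the form of a real symmetric matrix at a
  complex vector is the sum of its values at the real and at the imaginary part.
\<close>

lemma hermitian_psd_iff_quad:
  fixes M :: "complex ^ 'm ^ 'm"
  assumes sym: "\<And>i j. M $ i $ j = M $ j $ i"
  shows "hermitian_psd (M + conj_transpose M) \<longleftrightarrow> (\<forall>v. 0 \<le> Re (quad M v))"
proof -
  define H where "H = M + conj_transpose M"
  have H: "H $ i $ j = complex_of_real (2 * Re (M $ i $ j))" for i j
    using sym[of j i] by (simp add: H_def conj_transpose_def complex_add_cnj)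
  have herm: "conj_transpose H = H"
    using sym by (simp add: conj_transpose_def vec_eq_iff H)
  have form: "Re (\<Sum>i\<in>UNIV. cnj (V $ i) * (H *v V) $ i) =
      2 * Re (quad M (\<chi> i. Re (V $ i))) + 2 * Re (quad M (\<chi> i. Im (V $ i)))" for V
  proof -
    have "Re (cnj (V $ i) * (H $ i $ j * V $ j)) =
        2 * (Re (V $ i) * Re (V $ j) * Re (M $ i $ j)) + 2 * (Im (V $ i) * Im (V $ j) * Re (M $ i $ j))"
      for i j by (simp add: H algebra_simps)
    then show ?thesis
      by (simp only: matrix_vector_mult_def Re_quad vec_lambda_beta sum_distrib_left Re_sum sum.distrib)
  qed
  show ?thesis unfolding H_def[symmetric]
  proof
    assume psd: "hermitian_psd H"
    show "\<forall>v. 0 \<le> Re (quad M v)"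
    proof
      fix v
      have "0 \<le> Re (\<Sum>i\<in>UNIV. cnj (complexify v $ i) * (H *v complexify v) $ i)"
        using psd by (simp only: hermitian_psd_def)
      then have "0 \<le> 2 * Re (quad M (\<chi> i. Re (complexify v $ i))) +
          2 * Re (quad M (\<chi> i. Im (complexify v $ i)))"
        unfolding form .
      moreover have "(\<chi> i. Re (complexify v $ i)) = v" by (simp add: vec_eq_iff)
      moreover have "quad M (\<chi> i. Im (complexify v $ i)) = 0" by (simp add: quad_def)
      ultimately show "0 \<le> Re (quad M v)" by simp
    qed
  next
    assume "\<forall>v. 0 \<le> Re (quad M v)"
    then show "hermitian_psd H" unfolding hermitian_psd_def form using herm by simp
  qed
qed

section \<open>Multiaffine matrix polynomials\<close>

lemma real_multiaffine_mpoly_eval: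
  assumes "multiaffine p"
  shows "real_multiaffine (mpoly_eval (complex_mpoly p))"
  unfolding real_multiaffine_def
proof (intro conjI allI)
  fix k z w
  have "multiaffine (complex_mpoly p)" using assms by simp
  then show "mpoly_eval (complex_mpoly p) (upd z k w) = mpoly_eval (complex_mpoly p) (upd z k 0) +
      w * (mpoly_eval (complex_mpoly p) (upd z k 1) - mpoly_eval (complex_mpoly p) (upd z k 0))"
    by (simp add: multiaffine_eval_upd[of _ z k w] multiaffine_eval_upd[of _ z k 1])
qed (auto simp: mpoly_eval_cnj)

lemma real_multiaffine_real_combination:
  assumes "\<And>i. i \<in> I \<Longrightarrow> real_multiaffine (F i)"
  shows "real_multiaffine (\<lambda>z. \<Sum>i\<in>I. complex_of_real (c i) * F i z)"
  unfolding real_multiaffine_def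
proof (intro conjI allI)
  fix z
  show "(\<Sum>i\<in>I. complex_of_real (c i) * F i (\<chi> k. cnj (z $ k))) =
      cnj (\<Sum>i\<in>I. complex_of_real (c i) * F i z)"
    using assms by (simp add: real_multiaffine_def)
next
  fix k z w
  have "complex_of_real (c i) * F i (upd z k w) = complex_of_real (c i) * F i (upd z k 0) +
      w * (complex_of_real (c i) * F i (upd z k 1) - complex_of_real (c i) * F i (upd z k 0))"
    if "i \<in> I" for i
    by (subst real_multiaffine_affine[OF assms[OF that], of z k w]) (simp add: algebra_simps)
  then show "(\<Sum>i\<in>I. complex_of_real (c i) * F i (upd z k w)) =
      (\<Sum>i\<in>I. complex_of_real (c i) * F i (upd z k 0)) +
      w * ((\<Sum>i\<in>I. complex_of_real (c i) * F i (upd z k 1)) -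
        (\<Sum>i\<in>I. complex_of_real (c i) * F i (upd z k 0)))"
    by (simp add: sum_distrib_left sum.distrib[symmetric] sum_subtractf[symmetric])
next
  show "line_poly (\<lambda>z. \<Sum>i\<in>I. complex_of_real (c i) * F i z)"
    using assms by (intro line_poly_sum line_poly_mult line_poly_const real_multiaffine_line_poly)
qed

definition mat_eval :: "(real, 'd::finite) mpoly ^ 'm ^ 'm \<Rightarrow> complex ^ 'd \<Rightarrow> complex ^ 'm ^ 'm" where
  "mat_eval P z = (\<chi> i j. mpoly_eval (complex_mpoly (P $ i $ j)) z)"

lemma mat_eval_nth [simp]: "mat_eval P z $ i $ j = mpoly_eval (complex_mpoly (P $ i $ j)) z"
  by (simp add: mat_eval_def)

lemma real_multiaffine_quad:
  assumes "\<And>i j. multiaffine (P $ i $ j)"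
  shows "real_multiaffine (\<lambda>z. quad (mat_eval P z) v)"
proof -
  have "real_multiaffine (\<lambda>z. \<Sum>i\<in>UNIV. complex_of_real (v $ i) *
      (\<Sum>j\<in>UNIV. complex_of_real (v $ j) * mpoly_eval (complex_mpoly (P $ i $ j)) z))"
    by (intro real_multiaffine_real_combination real_multiaffine_mpoly_eval assms)
  then show ?thesis by (simp add: quad_def sum_distrib_left mult.assoc)
qed

lemma wronski_mpoly_eval:
  fixes p q :: "('a::comm_ring_1, 'd::finite) mpoly"
  assumes "multiaffine p" "multiaffine q"
  shows "wronski (mpoly_eval q) (mpoly_eval p) k z =
    mpoly_eval (q * mpoly_pderiv k p - p * mpoly_pderiv k q) z"
  using multiaffine_eval_upd[OF assms(1), of z k 1] multiaffine_eval_upd[OF assms(2), of z k 1]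
    multiaffine_eval_upd[OF assms(1), of z k "z $ k"] multiaffine_eval_upd[OF assms(2), of z k "z $ k"]
  by (simp add: wronski_def algebra_simps)

lemma upd_complexify: "upd (complexify x) k (complex_of_real w) = complexify (upd x k w)"
  by (simp add: vec_eq_iff upd_nth)

lemma wronski_complexify:
  "wronski (mpoly_eval (complex_mpoly q)) (mpoly_eval (complex_mpoly p)) k (complexify x) =
     complex_of_real (wronski (mpoly_eval q) (mpoly_eval p) k x)"
  using upd_complexify[of x k 0] upd_complexify[of x k 1]
  by (simp add: wronski_def mpoly_eval_complexify)

lemma wronski_quad:
  "wronski q (\<lambda>z. quad (mat_eval P z) v) k z =
     quad (\<chi> i j. wronski q (mpoly_eval (complex_mpoly (P $ i $ j))) k z) v"
  unfolding wronski_def quad_def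
  by (simp add: sum_distrib_left sum_distrib_right sum_subtractf[symmetric] algebra_simps)

lemma wronskian_quad_complexify:
  assumes "\<And>i j. multiaffine (P $ i $ j)" "multiaffine q"
  shows "v \<bullet> ((\<chi> i j. mpoly_eval (wronskian k q P $ i $ j) x) *v v) =
    Re (wronski (mpoly_eval (complex_mpoly q)) (\<lambda>z. quad (mat_eval P z) v) k (complexify x))"
  unfolding wronski_quad Re_quad inner_vec_def matrix_vector_mult_def
  by (simp add: wronski_complexify wronski_mpoly_eval assms wronskian_def sum_distrib_left algebra_simps)

lemma psd_wronskian_iff:
  fixes P :: "(real, 'd::finite) mpoly ^ 'm ^ 'm"
  assumes "\<And>i j. homogeneous n (P $ i $ j)" "homogeneous m q"
    and "\<And>i j. multiaffine (P $ i $ j)" "multiaffine q"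
  shows "psd_form (wronskian k q P) \<longleftrightarrow>
    (\<forall>x i j. mpoly_eval (wronskian k q P $ i $ j) x = mpoly_eval (wronskian k q P $ j $ i) x) \<and>
    (\<forall>x v. 0 \<le> Re (wronski (mpoly_eval (complex_mpoly q)) (\<lambda>z. quad (mat_eval P z) v) k (complexify x)))"
proof -
  have "real_matrix_form (wronskian k q P)"
    unfolding real_matrix_form_def
  proof (intro exI allI)
    show "homogeneous (n + m - 1) (wronskian k q P $ i $ j)" for i j
      using wronskian_homogeneous[OF assms(1,2), of k i j] by (simp add: wronskian_def)
  qed
  then show ?thesis
    unfolding psd_form_def Let_def wronskian_quad_complexify[OF assms(3,4)]
    by (auto simp: transpose_def vec_eq_iff)
qed

lemma real_point_complexify:
  assumes "real_point z"
  obtains x where "z = complexify x"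
  using that[of "\<chi> k. Re (z $ k)"] assms
  by (auto simp: real_point_def vec_eq_iff complex_eq_iff)

section \<open>Positivity on the half-plane forces nonnegative Wronskians\<close>

text \<open>
  The point \<open>y\<close> leaves the real space in the direction \<open>k\<close> only; it is approached from the upper
  poly-half-plane along \<open>L\<close>.
\<close>

lemma upper_imp_wronskian_nonneg:
  fixes p q :: "complex ^ 'd::finite \<Rightarrow> complex"
  assumes p: "real_multiaffine p" and q: "real_multiaffine q"
    and pos: "\<And>z. z \<in> upper_polyhalfplane \<Longrightarrow> 0 \<le> Im (p z * cnj (q z))"
    and z: "real_point z"
  shows "0 \<le> Re (wronski q p k z)"
proof -
  define y where "y = upd z k (z $ k + \<i>)"
  define L where "L t = y + t *s (\<chi> j. \<i>)" for t
  obtain rp where rp: "\<And>t. p (L t) = poly rp t"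
    unfolding L_def using line_polyE[OF real_multiaffine_line_poly[OF p]] by metis
  obtain rq where rq: "\<And>t. q (L t) = poly rq t"
    unfolding L_def using line_polyE[OF real_multiaffine_line_poly[OF q]] by metis
  have "L 0 = y" by (simp add: L_def)
  have upper: "L (of_real e) \<in> upper_polyhalfplane" if "0 < e" for e
    using that z by (auto simp: L_def y_def upper_polyhalfplane_def upd_nth real_point_def)
  have "((\<lambda>e::real. Im (poly rp (of_real e) * cnj (poly rq (of_real e)))) \<longlongrightarrow>
      Im (poly rp (of_real 0) * cnj (poly rq (of_real 0)))) (at_right 0)"
    by (intro tendsto_intros)
  moreover have "\<forall>\<^sub>F e::real in at_right 0. 0 \<le> Im (poly rp (of_real e) * cnj (poly rq (of_real e)))"
    using eventually_at_right_less[of "0::real"]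
    by eventually_elim (metis pos upper rp rq)
  ultimately have "0 \<le> Im (poly rp (of_real 0) * cnj (poly rq (of_real 0)))"
    by (rule tendsto_lowerbound) simp
  then have "0 \<le> Im (p y * cnj (q y))"
    using rp[of 0] rq[of 0] \<open>L 0 = y\<close> by simp
  moreover have "real_point (upd z k 0)" "real_point (upd z k 1)"
    using z by (auto simp: real_point_def upd_nth)
  then have im: "Im (p (upd z k 0)) = 0" "Im (p (upd z k 1)) = 0"
      "Im (q (upd z k 0)) = 0" "Im (q (upd z k 1)) = 0"
    using p q by (auto intro: real_multiaffine_real)
  have "Im (z $ k) = 0" using z by (simp add: real_point_def)
  have "Im (p y * cnj (q y)) = Re (wronski q p k z)"
    unfolding y_def real_multiaffine_affine[OF p, of z k "z $ k + \<i>"]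
      real_multiaffine_affine[OF q, of z k "z $ k + \<i>"] wronski_def
    using im \<open>Im (z $ k) = 0\<close> by (simp add: algebra_simps)
  ultimately show ?thesis by simp
qed

section \<open>Homogeneity\<close>

lemma matfun_value_iff:
  fixes P :: "(real, 'd::{finite, linorder}) mpoly ^ 'm ^ 'm"
  assumes "mpoly_eval (complex_mpoly q) z \<noteq> 0"
  shows "matfun_value (matrix_quotient P q) z W \<longleftrightarrow>
    (\<forall>i j. W $ i $ j = mat_eval P z $ i $ j / mpoly_eval (complex_mpoly q) z)"
  using assms by (simp add: matfun_value_def matrix_quotient_def ratfun_value_Fract)

text \<open>
  Homogeneity of the partial function \<open>f\<close> becomes an identity of polynomials. At the zeros of \<open>q\<close>
  both sides are zero since \<open>q\<close> is homogeneous.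
\<close>

lemma homogeneous_deg_one_cross:
  fixes P :: "(real, 'd::{finite, linorder}) mpoly ^ 'm ^ 'm"
  assumes hom: "homogeneous_deg_one (matrix_quotient P q)" and q: "homogeneous m q" and c: "c \<noteq> 0"
  shows "mat_eval P (c *s z) $ i $ j * mpoly_eval (complex_mpoly q) z =
    c * mat_eval P z $ i $ j * mpoly_eval (complex_mpoly q) (c *s z)"
proof -
  have q_scale: "mpoly_eval (complex_mpoly q) (c *s z) = c ^ m * mpoly_eval (complex_mpoly q) z"
    by (rule homogeneous_eval_scale) (simp add: q)
  show ?thesis
  proof (cases "mpoly_eval (complex_mpoly q) z = 0")
    case False
    then have qc: "mpoly_eval (complex_mpoly q) (c *s z) \<noteq> 0" using c by (simp add: q_scale)
    define W where "W = (\<chi> i j. mat_eval P z $ i $ j / mpoly_eval (complex_mpoly q) z)"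
    have "matfun_value (matrix_quotient P q) z W"
      unfolding matfun_value_iff[OF False] by (simp add: W_def)
    then have "matfun_value (matrix_quotient P q) (c *s z) (\<chi> i j. c * W $ i $ j)"
      using hom c by (simp add: homogeneous_deg_one_def)
    then have "c * W $ i $ j = mat_eval P (c *s z) $ i $ j / mpoly_eval (complex_mpoly q) (c *s z)"
      unfolding matfun_value_iff[OF qc] by simp
    then show ?thesis using False qc by (simp add: W_def field_simps)
  qed (simp add: q_scale)
qed

lemma degree_difference:
  fixes P :: "(real, 'd::{finite, linorder}) mpoly ^ 'm ^ 'm"
  assumes hom: "homogeneous_deg_one (matrix_quotient P q)"
    and P: "homogeneous n (P $ i $ j)" "multiaffine (P $ i $ j)" "P $ i $ j \<noteq> 0"
    and q: "homogeneous m q" "multiaffine q" "q \<noteq> 0"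
  shows "n = Suc m"
proof (rule ccontr)
  assume "n \<noteq> Suc m"
  let ?p = "complex_mpoly (P $ i $ j)" and ?q = "complex_mpoly q"
  have "mpoly_eval ?p z * mpoly_eval ?q z = 0" for z
  proof -
    have "mpoly_eval ?p (2 *s z) * mpoly_eval ?q z = 2 * mpoly_eval ?p z * mpoly_eval ?q (2 *s z)"
      using homogeneous_deg_one_cross[OF hom q(1), of 2 z i j] by simp
    moreover have "mpoly_eval ?p (2 *s z) = 2 ^ n * mpoly_eval ?p z"
      "mpoly_eval ?q (2 *s z) = 2 ^ m * mpoly_eval ?q z"
      by (rule homogeneous_eval_scale; simp add: P q)+
    ultimately have "(2 ^ n - 2 ^ Suc m) * (mpoly_eval ?p z * mpoly_eval ?q z) = 0"
      by (simp add: algebra_simps)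
    moreover have "(2::complex) ^ n \<noteq> 2 ^ Suc m"
    proof
      assume "(2::complex) ^ n = 2 ^ Suc m"
      then have "cmod (2 ^ n) = cmod (2 ^ Suc m)" by simp
      then have "(2::real) ^ n = 2 ^ Suc m" by (simp only: norm_power norm_numeral)
      then show False using \<open>n \<noteq> Suc m\<close> power_inject_exp[of "2::real" n "Suc m"] by simp
    qed
    ultimately show ?thesis by simp
  qed
  moreover obtain x where "mpoly_eval ?p x \<noteq> 0"
    using multiaffine_homogeneous_eval_nonzero[of ?p n] P by auto
  ultimately have "mpoly_eval ?q z = 0" for z
    using line_poly_no_zero_divisors[of "mpoly_eval ?p" "mpoly_eval ?q"] by blast
  then show False
    using multiaffine_homogeneous_eval_nonzero[of ?q m] q by auto
qed

text \<open>
  By Euler's identity the Wronskians of an entry \<open>p\<close>, weighted with the variables, add up to the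
  difference of the degrees times \<open>q p\<close>. This difference is one, so the Wronskians determine \<open>q p\<close>
  and thereby \<open>p\<close>.
\<close>

lemma symmetric_of_wronskian:
  fixes P :: "(real, 'd::{finite, linorder}) mpoly ^ 'm ^ 'm"
  assumes hom: "homogeneous_deg_one (matrix_quotient P q)"
    and P: "\<And>i j. homogeneous n (P $ i $ j)" "\<And>i j. multiaffine (P $ i $ j)"
    and q: "homogeneous m q" "multiaffine q" "q \<noteq> 0"
    and W: "\<And>k x i j. mpoly_eval (wronskian k q P $ i $ j) x = mpoly_eval (wronskian k q P $ j $ i) x"
  shows "P $ i $ j = P $ j $ i"
proof (rule ccontr)
  assume neq: "P $ i $ j \<noteq> P $ j $ i"
  then have "P $ i $ j \<noteq> 0 \<or> P $ j $ i \<noteq> 0" by auto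
  then have n: "n = Suc m" using degree_difference[OF hom P _ q] by blast
  have euler: "(\<Sum>k\<in>UNIV. x $ k * mpoly_eval (wronskian k q P $ i $ j) x) =
      mpoly_eval q x * mpoly_eval (P $ i $ j) x" for x i j
  proof -
    have "(\<Sum>k\<in>UNIV. x $ k * mpoly_eval (wronskian k q P $ i $ j) x) =
        mpoly_eval q x * (\<Sum>k\<in>UNIV. x $ k * mpoly_eval (mpoly_pderiv k (P $ i $ j)) x) -
        mpoly_eval (P $ i $ j) x * (\<Sum>k\<in>UNIV. x $ k * mpoly_eval (mpoly_pderiv k q) x)"
      by (simp add: wronskian_def sum_distrib_left sum_subtractf[symmetric] algebra_simps)
    then show ?thesis
      unfolding euler_identity[OF P(1)] euler_identity[OF q(1)] n by (simp add: algebra_simps)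
  qed
  let ?A = "P $ i $ j - P $ j $ i"
  have "mpoly_eval q x * mpoly_eval ?A x = 0" for x
    using euler[of x i j] euler[of x j i] W by (simp add: algebra_simps)
  moreover obtain x where "mpoly_eval q x \<noteq> 0"
    using multiaffine_homogeneous_eval_nonzero[OF q(2,1,3)] .
  ultimately have "mpoly_eval ?A x = 0" for x
    using line_poly_no_zero_divisors[of "mpoly_eval q" "mpoly_eval ?A"] by blast
  moreover obtain x where "mpoly_eval ?A x \<noteq> 0"
  proof (rule multiaffine_homogeneous_eval_nonzero)
    show "multiaffine ?A" "homogeneous n ?A" "?A \<noteq> 0"
      using P neq by (auto intro: multiaffine_diff homogeneous_diff)
  qed
  ultimately show False by blast
qed

section \<open>Holomorphy\<close>

text \<open>
  Complex differentiability of scalar functions in the form in which it occurs in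
  \<open>matrix_holomorphic_on\<close>, with the closure properties that give it for quotients of polynomials.
\<close>

definition holomorphic_at :: "(complex ^ 'd::finite \<Rightarrow> complex) \<Rightarrow> complex ^ 'd \<Rightarrow> bool" where
  "holomorphic_at F z \<longleftrightarrow>
     (\<exists>c :: complex ^ 'd. (F has_derivative (\<lambda>h. \<Sum>k\<in>UNIV. c $ k * h $ k)) (at z))"

lemma holomorphic_atI:
  assumes "(F has_derivative D) (at z)" "\<And>h. D h = (\<Sum>k\<in>UNIV. c k * h $ k)"
  shows "holomorphic_at F z"
proof -
  have "D = (\<lambda>h. \<Sum>k\<in>UNIV. (\<chi> k. c k) $ k * h $ k)" using assms(2) by (simp add: fun_eq_iff)
  then show ?thesis using assms(1) unfolding holomorphic_at_def by blast
qed

lemma holomorphic_at_const: "holomorphic_at (\<lambda>z. a) z"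
  by (rule holomorphic_atI[where c = "\<lambda>_. 0"]) (auto intro: has_derivative_const)

lemma holomorphic_at_nth: "holomorphic_at (\<lambda>z. z $ k) z"
proof (rule holomorphic_atI)
  show "((\<lambda>z. z $ k) has_derivative (\<lambda>h. h $ k)) (at z)"
    by (rule bounded_linear_imp_has_derivative) (rule bounded_linear_vec_nth)
  show "h $ k = (\<Sum>j\<in>UNIV. (if j = k then 1 else 0) * h $ j)" for h :: "complex ^ 'a"
  proof -
    have "(if j = k then 1 else 0) * h $ j = (if j = k then h $ j else 0)" for j by simp
    then show ?thesis by simp
  qed
qed

lemma holomorphic_at_add:
  assumes "holomorphic_at F z" "holomorphic_at G z"
  shows "holomorphic_at (\<lambda>z. F z + G z) z"
proof -
  obtain c d :: "complex ^ 'a" where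
    *: "(F has_derivative (\<lambda>h. \<Sum>k\<in>UNIV. c $ k * h $ k)) (at z)"
    "(G has_derivative (\<lambda>h. \<Sum>k\<in>UNIV. d $ k * h $ k)) (at z)"
    using assms unfolding holomorphic_at_def by blast
  show ?thesis
    by (rule holomorphic_atI[OF has_derivative_add[OF *], where c = "\<lambda>k. c $ k + d $ k"])
      (simp add: sum.distrib algebra_simps)
qed

lemma holomorphic_at_mult:
  assumes "holomorphic_at F z" "holomorphic_at G z"
  shows "holomorphic_at (\<lambda>z. F z * G z) z"
proof -
  obtain c d :: "complex ^ 'a" where
    *: "(F has_derivative (\<lambda>h. \<Sum>k\<in>UNIV. c $ k * h $ k)) (at z)"
    "(G has_derivative (\<lambda>h. \<Sum>k\<in>UNIV. d $ k * h $ k)) (at z)"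
    using assms unfolding holomorphic_at_def by blast
  show ?thesis
    by (rule holomorphic_atI[OF has_derivative_mult[OF *], where c = "\<lambda>k. F z * d $ k + c $ k * G z"])
      (simp add: sum.distrib sum_distrib_left sum_distrib_right algebra_simps)
qed

lemma holomorphic_at_inverse:
  assumes "holomorphic_at F z" "F z \<noteq> 0"
  shows "holomorphic_at (\<lambda>z. inverse (F z)) z"
proof -
  obtain c :: "complex ^ 'a" where
    *: "(F has_derivative (\<lambda>h. \<Sum>k\<in>UNIV. c $ k * h $ k)) (at z)"
    using assms unfolding holomorphic_at_def by blast
  show ?thesis
    by (rule holomorphic_atI[OF Deriv.has_derivative_inverse[OF assms(2) *],
          where c = "\<lambda>k. - (inverse (F z) * c $ k * inverse (F z))"])
      (simp add: sum_distrib_left sum_distrib_right sum_negf algebra_simps)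
qed

lemma holomorphic_at_sum:
  "(\<And>i. i \<in> I \<Longrightarrow> holomorphic_at (F i) z) \<Longrightarrow> holomorphic_at (\<lambda>z. \<Sum>i\<in>I. F i z) z"
  by (induction I rule: infinite_finite_induct)
    (auto intro: holomorphic_at_const holomorphic_at_add)

lemma holomorphic_at_prod:
  "(\<And>i. i \<in> I \<Longrightarrow> holomorphic_at (F i) z) \<Longrightarrow> holomorphic_at (\<lambda>z. \<Prod>i\<in>I. F i z) z"
  by (induction I rule: infinite_finite_induct)
    (auto intro: holomorphic_at_const holomorphic_at_mult)

lemma holomorphic_at_power: "holomorphic_at F z \<Longrightarrow> holomorphic_at (\<lambda>z. F z ^ n) z"
  by (induction n) (auto intro: holomorphic_at_const holomorphic_at_mult)

lemma holomorphic_at_mpoly_eval: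
  assumes "\<And>k. holomorphic_at (\<lambda>z. \<phi> z $ k) z"
  shows "holomorphic_at (\<lambda>z. mpoly_eval p (\<phi> z)) z"
  unfolding mpoly_eval_def
  by (intro holomorphic_at_sum holomorphic_at_mult holomorphic_at_const holomorphic_at_prod
      holomorphic_at_power assms)


section \<open>Membership in the class\<close>

lemma transpose_matrix_quotient:
  fixes P :: "(real, 'd::{finite, linorder}) mpoly ^ 'm ^ 'm"
  assumes "q \<noteq> 0"
  shows "transpose (matrix_quotient P q) = matrix_quotient P q \<longleftrightarrow> (\<forall>i j. P $ i $ j = P $ j $ i)"
  using assms by (auto simp: transpose_def matrix_quotient_def vec_eq_iff eq_fract)

lemma upper_of_right:
  "z \<in> right_polyhalfplane \<longleftrightarrow> \<i> *s z \<in> upper_polyhalfplane"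
  by (simp add: right_polyhalfplane_def upper_polyhalfplane_def)

lemma RP_class_imp_upper:
  fixes P :: "(real, 'd::{finite, linorder}) mpoly ^ 'm ^ 'm"
  assumes RP: "matrix_quotient P q \<in> RP_class"
    and q: "homogeneous m q" "q \<noteq> 0"
    and z: "z \<in> upper_polyhalfplane"
  shows "0 \<le> Im (quad (mat_eval P z) v * cnj (mpoly_eval (complex_mpoly q) z))"
proof (cases "mpoly_eval (complex_mpoly q) z = 0")
  case False
  obtain g where g: "\<And>z W. z \<in> right_polyhalfplane \<Longrightarrow> matfun_value (matrix_quotient P q) z W \<Longrightarrow> g z = W"
    and psd: "\<And>z. z \<in> right_polyhalfplane \<Longrightarrow> hermitian_psd (g z + conj_transpose (g z))"
    using RP unfolding RP_class_def by blast
  have hom: "homogeneous_deg_one (matrix_quotient P q)" and sym: "\<And>i j. P $ i $ j = P $ j $ i"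
    using RP transpose_matrix_quotient[OF q(2), of P] unfolding RP_class_def by blast+
  define u where "u = (- \<i>) *s z"
  have iu: "\<i> *s u = z" by (simp add: u_def vec_eq_iff)
  have u: "u \<in> right_polyhalfplane" using z by (simp add: upper_of_right iu)
  have "mpoly_eval (complex_mpoly q) z = \<i> ^ m * mpoly_eval (complex_mpoly q) u"
    unfolding iu[symmetric] by (rule homogeneous_eval_scale) (simp add: q)
  then have qu: "mpoly_eval (complex_mpoly q) u \<noteq> 0" using False by auto
  define W where "W = (\<chi> i j. mat_eval P u $ i $ j / mpoly_eval (complex_mpoly q) u)"
  have "matfun_value (matrix_quotient P q) u W"
    unfolding matfun_value_iff[OF qu] by (simp add: W_def)
  then have "hermitian_psd (W + conj_transpose W)" using g[OF u] psd[OF u] by simp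
  moreover have "W $ i $ j = W $ j $ i" for i j by (simp add: W_def sym[of i j])
  ultimately have Re: "0 \<le> Re (quad W v)" using hermitian_psd_iff_quad by blast
  define c where "c = \<i> * mpoly_eval (complex_mpoly q) z"
  have "mat_eval P z $ i $ j = c * W $ i $ j" for i j
    using homogeneous_deg_one_cross[OF hom q(1), of \<i> u i j] qu
    unfolding iu by (simp add: W_def c_def field_simps)
  then have "mat_eval P z = (\<chi> i j. c * W $ i $ j)" by (simp add: vec_eq_iff)
  then have "quad (mat_eval P z) v = c * quad W v" by (simp only: quad_cmult)
  then have "quad (mat_eval P z) v * cnj (mpoly_eval (complex_mpoly q) z) =
      \<i> * quad W v * of_real ((cmod (mpoly_eval (complex_mpoly q) z))\<^sup>2)"
    unfolding complex_norm_square c_def by (simp only: mult.assoc mult.left_commute mult.commute)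
  then show ?thesis using Re by simp
qed simp

text \<open>
  The holomorphic extension is \<open>g(z) = -\<i> P(\<sigma>(\<i> z)) / q(\<sigma>(\<i> z))\<close>, where \<open>\<sigma>\<close> substitutes real numbers
  for some coordinates and makes the denominator free of zeros. It agrees with \<open>f\<close> wherever
  any representation of \<open>f\<close> has a value, since the two differ by a polynomial identity that
  may be multiplied by nonzero polynomials.
\<close>

lemma wronskian_nonneg_imp_RP_class:
  fixes P :: "(real, 'd::{finite, linorder}) mpoly ^ 'm ^ 'm"
  assumes hom: "homogeneous_deg_one (matrix_quotient P q)"
    and P: "\<And>i j. multiaffine (P $ i $ j)" "\<And>i j. P $ i $ j = P $ j $ i"
    and q: "homogeneous m q" "multiaffine q" "q \<noteq> 0"
    and W: "\<And>v k z. real_point z \<Longrightarrow>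
      0 \<le> Re (wronski (mpoly_eval (complex_mpoly q)) (\<lambda>z. quad (mat_eval P z) v) k z)"
  shows "matrix_quotient P q \<in> RP_class"
proof -
  define Q where "Q = mpoly_eval (complex_mpoly q)"
  have rQ: "real_multiaffine Q" unfolding Q_def by (rule real_multiaffine_mpoly_eval) (rule q)
  have rP: "real_multiaffine (\<lambda>z. quad (mat_eval P z) v)" for v
    by (rule real_multiaffine_quad) (rule P)
  obtain z0 where z0: "Q z0 \<noteq> 0"
  proof (rule multiaffine_homogeneous_eval_nonzero)
    show "multiaffine (complex_mpoly q)" "homogeneous m (complex_mpoly q)" "complex_mpoly q \<noteq> 0"
      using q by simp_all
  qed (simp add: Q_def)
  obtain K x where x: "real_point x"
    and nz: "\<And>z. z \<in> upper_polyhalfplane \<Longrightarrow> Q (substitute K x z) \<noteq> 0"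
    and cross: "\<And>v z. quad (mat_eval P z) v * Q (substitute K x z) =
      quad (mat_eval P (substitute K x z)) v * Q z"
    by (rule denominator_free_of_zeros[where q = Q and p = "\<lambda>v z. quad (mat_eval P z) v",
          OF rQ rP W[folded Q_def] z0]) (assumption, rule that)
  define \<sigma> where "\<sigma> = substitute K x"
  have entry: "mat_eval P z $ i $ j * Q (\<sigma> z) = mat_eval P (\<sigma> z) $ i $ j * Q z" for z i j
  proof -
    let ?M = "\<chi> i j. Q (\<sigma> z) * mat_eval P z $ i $ j - Q z * mat_eval P (\<sigma> z) $ i $ j"
    have "?M $ i $ j = 0"
    proof (rule quad_eq_0_imp)
      show "?M $ i $ j = ?M $ j $ i" for i j by (simp add: P(2)[of i j])
      have "?M = (\<chi> i j. (\<chi> i j. Q (\<sigma> z) * mat_eval P z $ i $ j) $ i $ j -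
          (\<chi> i j. Q z * mat_eval P (\<sigma> z) $ i $ j) $ i $ j)"
        by (simp add: vec_eq_iff)
      then have "quad ?M v = Q (\<sigma> z) * quad (mat_eval P z) v - Q z * quad (mat_eval P (\<sigma> z)) v" for v
        by (simp only: quad_diff[symmetric] quad_cmult)
      then show "quad ?M v = 0" for v using cross[of z v] by (simp add: \<sigma>_def mult.commute)
    qed
    then show ?thesis by (simp add: mult.commute)
  qed
  define g :: "complex ^ ('d::{finite, linorder}) \<Rightarrow> complex ^ 'm ^ 'm" where
    "g z = (\<chi> i j. - \<i> * mat_eval P (\<sigma> (\<i> *s z)) $ i $ j * inverse (Q (\<sigma> (\<i> *s z))))" for z
  have Q_nz: "Q (\<sigma> (\<i> *s z)) \<noteq> 0" if "z \<in> right_polyhalfplane" for z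
    using nz that by (simp add: \<sigma>_def upper_of_right)
  have "matrix_holomorphic_on g right_polyhalfplane"
    unfolding matrix_holomorphic_on_def holomorphic_at_def[symmetric]
  proof (intro ballI allI)
    fix z :: "complex ^ ('d::{finite, linorder})" and i j assume z: "z \<in> right_polyhalfplane"
    have "holomorphic_at (\<lambda>z. \<sigma> (\<i> *s z) $ k) z" for k
      unfolding \<sigma>_def substitute_nth vector_smult_component
      by (cases "k \<in> K") (simp_all add: holomorphic_at_const holomorphic_at_mult holomorphic_at_nth)
    note poly = holomorphic_at_mpoly_eval[OF this]
    show "holomorphic_at (\<lambda>z. g z $ i $ j) z"
      unfolding g_def vec_lambda_beta mat_eval_nth Q_def
      by (intro holomorphic_at_mult holomorphic_at_inverse holomorphic_at_const poly)
        (use Q_nz[OF z] in \<open>simp add: Q_def\<close>)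
  qed
  moreover have "g z = U" if z: "z \<in> right_polyhalfplane"
    and U: "matfun_value (matrix_quotient P q) z U" for z U
  proof -
    have "g z $ i $ j = U $ i $ j" for i j
    proof -
      have "ratfun_value (Fract (complex_mpoly (P $ i $ j)) (complex_mpoly q)) z (U $ i $ j)"
        using U by (simp add: matfun_value_def matrix_quotient_def)
      then obtain a b where ab: "a * complex_mpoly q = complex_mpoly (P $ i $ j) * b"
        and b: "mpoly_eval b z \<noteq> 0" and U_eq: "U $ i $ j = mpoly_eval a z / mpoly_eval b z"
        using ratfun_value_cross q(3) by (metis complex_mpoly_eq_0_iff)
      define p where "p = mpoly_eval (complex_mpoly (P $ i $ j))"
      \<comment> \<open>\<open>T = 0\<close> says that \<open>g = a / b\<close>; it is proved after multiplication with \<open>Q y\<close> and \<open>Q (\<i> *s y)\<close>.\<close>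
      define T where "T y = mpoly_eval a y * Q (\<sigma> (\<i> *s y)) + \<i> * p (\<sigma> (\<i> *s y)) * mpoly_eval b y" for y
      have lp_i: "line_poly (\<lambda>y. F (\<i> *s y))" if "line_poly F" for F :: "complex ^ ('d::{finite, linorder}) \<Rightarrow> complex"
        using that by (rule line_poly_compose[where \<tau> = "\<lambda>b. \<i> *s b"])
          (simp add: vec_eq_iff algebra_simps)
      have lp_Q: "line_poly Q" and lp_p: "line_poly p" unfolding Q_def p_def by blast+
      have lp_T: "line_poly T" unfolding T_def \<sigma>_def
        by (intro line_poly_add line_poly_mult line_poly_const line_poly_mpoly_eval
            lp_i[OF line_poly_substitute[OF lp_Q]] lp_i[OF line_poly_substitute[OF lp_p]])
      have "Q y * (Q (\<i> *s y) * T y) = 0" for y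
      proof -
        have 1: "mpoly_eval a y * Q y = p y * mpoly_eval b y"
          using arg_cong[OF ab, of "\<lambda>r. mpoly_eval r y"] by (simp add: Q_def p_def)
        have 2: "p (\<i> *s y) * Q (\<sigma> (\<i> *s y)) = p (\<sigma> (\<i> *s y)) * Q (\<i> *s y)"
          using entry[of "\<i> *s y" i j] by (simp add: p_def)
        have 3: "p (\<i> *s y) * Q y = \<i> * p y * Q (\<i> *s y)"
          using homogeneous_deg_one_cross[OF hom q(1), of \<i> y i j] by (simp add: p_def Q_def)
        have "Q y * (Q (\<i> *s y) * T y) = (mpoly_eval a y * Q y) * Q (\<i> *s y) * Q (\<sigma> (\<i> *s y)) +
            \<i> * mpoly_eval b y * Q y * (p (\<sigma> (\<i> *s y)) * Q (\<i> *s y))"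
          by (simp add: T_def algebra_simps)
        also have "\<dots> = p y * mpoly_eval b y * Q (\<i> *s y) * Q (\<sigma> (\<i> *s y)) +
            \<i> * mpoly_eval b y * Q (\<sigma> (\<i> *s y)) * (p (\<i> *s y) * Q y)"
          unfolding 1 2[symmetric] by (simp add: algebra_simps)
        also have "\<dots> = (1 + \<i> * \<i>) * (p y * mpoly_eval b y * Q (\<i> *s y) * Q (\<sigma> (\<i> *s y)))"
          unfolding 3 by (simp only: distrib_left distrib_right mult_1_left mult.assoc mult.left_commute mult.commute)
        also have "\<dots> = 0" by simp
        finally show ?thesis .
      qed
      then have "Q (\<i> *s y) * T y = 0" for y
        using line_poly_no_zero_divisors[OF lp_Q line_poly_mult[OF lp_i[OF lp_Q] lp_T] _ z0] by blast
      moreover have "Q (\<i> *s ((- \<i>) *s z0)) \<noteq> 0" using z0 by (simp add: vector_smult_assoc)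
      ultimately have "T z = 0"
        using line_poly_no_zero_divisors[OF lp_i[OF lp_Q] lp_T] by blast
      then have "mpoly_eval a z * Q (\<sigma> (\<i> *s z)) = - \<i> * p (\<sigma> (\<i> *s z)) * mpoly_eval b z"
        by (simp add: T_def add_eq_0_iff2)
      then show ?thesis
        using b Q_nz[OF z] by (simp add: U_eq g_def p_def field_simps)
    qed
    then show ?thesis by (simp add: vec_eq_iff)
  qed
  moreover have "hermitian_psd (g z + conj_transpose (g z))" if z: "z \<in> right_polyhalfplane" for z
  proof -
    have g_sym: "g z $ i $ j = g z $ j $ i" for i j by (simp add: g_def P(2)[of i j])
    have "0 \<le> Re (quad (g z) v)" for v
    proof -
      let ?y = "\<i> *s z"
      let ?q = "Q (\<sigma> ?y)" and ?p = "quad (mat_eval P (\<sigma> ?y)) v"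
      have rs: "real_multiaffine (\<lambda>z. Q (\<sigma> z))" "real_multiaffine (\<lambda>z. quad (mat_eval P (\<sigma> z)) v)"
        unfolding \<sigma>_def
        by (rule real_multiaffine_substitute[OF rQ x] real_multiaffine_substitute[OF rP x])+
      have "0 \<le> Im (?p * cnj ?q)"
      proof (rule wronskian_nonneg_imp_upper[OF rs(2,1)])
        show "?y \<in> upper_polyhalfplane" using z by (simp add: upper_of_right)
        fix k and r :: "complex ^ ('d::{finite, linorder})" assume "real_point r"
        then have "real_point (\<sigma> r)" using x by (simp add: \<sigma>_def real_point_def substitute_nth)
        then show "0 \<le> Re (wronski (\<lambda>z. Q (\<sigma> z)) (\<lambda>z. quad (mat_eval P (\<sigma> z)) v) k r)"
          using W unfolding \<sigma>_def wronski_substitute[where p = "\<lambda>z. quad (mat_eval P z) v"] by (simp add: Q_def)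
      qed
      moreover have "quad (g z) v = (- \<i> * inverse ?q) * ?p"
        unfolding quad_cmult[symmetric] g_def by (simp only: mult.assoc mult.left_commute mult.commute)
      moreover have "Re ((- \<i> * inverse ?q) * ?p) = Im (?p * cnj ?q) / (cmod ?q)\<^sup>2"
      proof -
        have "(- \<i> * inverse ?q) * ?p = - \<i> * (?p / ?q)" by (simp add: divide_inverse)
        also have "?p / ?q = (?p * cnj ?q) / of_real ((cmod ?q)\<^sup>2)"
          using complex_div_cnj[of ?p ?q] by simp
        finally have eq: "(- \<i> * inverse ?q) * ?p = - \<i> * ((?p * cnj ?q) / of_real ((cmod ?q)\<^sup>2))" .
        have "Re (- \<i> * w) = Im w" for w by simp
        then show ?thesis unfolding eq by (simp only: Im_divide_of_real)
      qed
      ultimately show ?thesis by simp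
    qed
    then show ?thesis using hermitian_psd_iff_quad[OF g_sym] by blast
  qed
  moreover have "matfun_value (matrix_quotient P q) (\<chi> k. cnj (z $ k)) (\<chi> i j. cnj (U $ i $ j)) \<longleftrightarrow>
      matfun_value (matrix_quotient P q) z U" for z U
  proof -
    have conj: "matfun_value (matrix_quotient P q) (\<chi> k. cnj (z $ k)) (\<chi> i j. cnj (U $ i $ j))"
      if "matfun_value (matrix_quotient P q) z U" for z U
      using that ratfun_value_cnj[OF q(3)] by (auto simp: matfun_value_def matrix_quotient_def)
    show ?thesis using conj[of z U] conj[of "\<chi> k. cnj (z $ k)" "\<chi> i j. cnj (U $ i $ j)"] by auto
  qed
  ultimately show ?thesis
    unfolding RP_class_def using hom transpose_matrix_quotient[OF q(3), of P] P(2) by blast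
qed

theorem theorem3p7:
  fixes P :: "(real, 'd::{finite, linorder}) mpoly ^ 'm ^ 'm"
    and q :: "(real, 'd) mpoly"
    and f :: "'d ratfun ^ 'm ^ 'm"
  assumes "real_matrix_form P"
    and "real_form q"
    and "q \<noteq> 0"
    and "f = matrix_quotient P q"
    and "\<And>i j. multiaffine (P $ i $ j)"
    and "multiaffine q"
    and "homogeneous_deg_one f"
  shows "f \<in> RP_class \<longleftrightarrow> (\<forall>k. psd_form (wronskian k q P))"
proof -
  obtain n where P: "\<And>i j. homogeneous n (P $ i $ j)"
    using assms(1) unfolding real_matrix_form_def by blast
  obtain m where q: "homogeneous m q" using assms(2) unfolding real_form_def by blast
  note hom = assms(7)[unfolded assms(4)]
  note psd_iff = psd_wronskian_iff[OF P q assms(5,6)]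
  have rq: "real_multiaffine (mpoly_eval (complex_mpoly q))"
    by (rule real_multiaffine_mpoly_eval) (rule assms(6))
  have rP: "real_multiaffine (\<lambda>z. quad (mat_eval P z) v)" for v
    by (rule real_multiaffine_quad) (rule assms(5))
  show ?thesis
  proof
    assume "f \<in> RP_class"
    then have RP: "matrix_quotient P q \<in> RP_class" by (simp add: assms(4))
    then have sym: "P $ i $ j = P $ j $ i" for i j
      using transpose_matrix_quotient[OF assms(3), of P] unfolding RP_class_def by blast
    have "real_point (complexify x)" for x :: "real ^ ('d::{finite, linorder})" by (simp add: real_point_def)
    then have "0 \<le> Re (wronski (mpoly_eval (complex_mpoly q)) (\<lambda>z. quad (mat_eval P z) v) k (complexify x))"
      for x v k
      using RP_class_imp_upper[OF RP q assms(3)] by (intro upper_imp_wronskian_nonneg[OF rP rq])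
    moreover have "wronskian k q P $ i $ j = wronskian k q P $ j $ i" for k i j
      by (simp add: wronskian_def sym[of i j])
    ultimately show "\<forall>k. psd_form (wronskian k q P)" unfolding psd_iff by metis
  next
    assume psd: "\<forall>k. psd_form (wronskian k q P)"
    then have sym: "P $ i $ j = P $ j $ i" for i j
      using symmetric_of_wronskian[OF hom P assms(5) q assms(6,3)] unfolding psd_iff by blast
    have "0 \<le> Re (wronski (mpoly_eval (complex_mpoly q)) (\<lambda>z. quad (mat_eval P z) v) k z)"
      if "real_point z" for z v k
      using psd real_point_complexify[OF that] unfolding psd_iff by metis
    then have "matrix_quotient P q \<in> RP_class"
      by (intro wronskian_nonneg_imp_RP_class[OF hom assms(5) sym q assms(6,3)])
    then show "f \<in> RP_class" by (simp add: assms(4))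
  qed
qed

end
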